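(* Work in the setting and under the standing assumptions stated in the context. For all values of $\lambda_*\in\mathbb{R}$, every $g\in L^+_\infty(D\times V)$ with $\langle g,\tilde\varphi\rangle>0$ and every $(r,\upsilon)\in D\times V$, there exist $\tilde\kappa_{[1]}>0$ and $\lambda_1\in\mathbb{R}$ such that $$\mathbf{E}_{(r,\upsilon)}\Big[\big(\Psi^{\mathrm{rw}}_k[g](t,r,\upsilon)^{1/t}-e^{\lambda_*}\big)^2\Big]\le\frac{\tilde\kappa_{[1]}}{k}\,e^{(\lambda_1-2\lambda_* )t}+\frac{\kappa_{[0]}}{t^2}$$ as $t\to\infty$ (i.e. for all sufficiently large $t$). Moreover, $$\max\{2\lambda_*,\ \lambda_*+\underline\beta\}\le\lambda_1\le\lambda_*+\overline\beta .$$
   Context: Domain and cross-sections. $D\subset\mathbb{R}^3$ is non-empty, open, smooth, bounded and convex; $V=\{\upsilon\in\mathbb{R}^3:\upsilon_{\min}\le|\upsilon|\le\upsilon_{\max}\}$ with $0<\upsilon_{\min}<\upsilon_{\max}<\infty$. $L^+_\infty(D\times V)$ is the set of non-negative bounded measurable functions on $D\times V$; $\langle f,g\rangle=\int_{D\times V}f g\,dr\,d\upsilon$. Measurable non-negative functions $\sigma_{\mathrm s}(r,\upsilon),\sigma_{\mathrm f}(r,\upsilon),\pi_{\mathrm s}(r,\upsilon,\upsilon'),\pi_{\mathrm f}(r,\upsilon,\upsilon')$ are given, with $\int_V\pi_{\mathrm s}(r,\upsilon,\upsilon')d\upsilon'=1$. Standing assumptions: all four functions are bounded; $\inf_{r\in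 D,\upsilon,\upsilon'\in V}(\sigma_{\mathrm s}(r,\upsilon)\pi_{\mathrm s}(r,\upsilon,\upsilon')+\sigma_{\mathrm f}(r,\upsilon)\pi_{\mathrm f}(r,\upsilon,\upsilon'))>0$; there is an open ball $B$ compactly embedded in $D$ with $\inf_{r\in B,\upsilon,\upsilon'\in V}\sigma_{\mathrm f}(r,\upsilon)\pi_{\mathrm f}(r,\upsilon,\upsilon')>0$; $\sup_{r,\upsilon}\int_V\pi_{\mathrm f}(r,\upsilon,\upsilon')d\upsilon'\le n_{\max}$ for a constant $n_{\max}>1$. Neutron random walk (NRW). Define a rate $\alpha$ and probability densities $\pi(r,\upsilon,\cdot)$ on $V$ by $\alpha(r,\upsilon)\pi(r,\upsilon,\upsilon')=\sigma_{\mathrm s}(r,\upsilon)\pi_{\mathrm s}(r,\upsilon,\upsilon')+\sigma_{\mathrm f}(r,\upsilon)\pi_{\mathrm f}(r,\upsilon,\upsilon')$. The $\alpha\pi$-NRW $(R_t,\Upsilon_t)_{t\ge0}$ moves in a straight line with its current velocity, scatters at rate $\alpha(R_t,\Upsilon_t)$ to a new velocity with density $\pi(R_t,\Upsilon_t,\cdot)$, and is killed at $\tau^D=\inf\{t>0:R_t\notin D\}$. Its law from $(r,\upsilon)$ is $\mathbf{P}_{(r,\upsilon)}$. Put $\beta(r,\upsilon)=\sigma_{\mathrm f}(r,\upsilon)(\int_V\pi_{\mathrm f}(r,\upsilon,\upsilon')d\upsilon'-1)$, $\overline\beta=\sup_{D\times V}\beta$, $\underline\beta=\inf_{D\times V}\beta$,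 and $\psi_t[g](r,\upsilon)=\mathbf{E}_{(r,\upsilon)}[e^{\int_0^t\beta(R_s,\Upsilon_s)ds}g(R_t,\Upsilon_t)\mathbf 1_{(t<\tau^D)}]$. Leading eigen-triple (known): there exist $\lambda_*\in\mathbb{R}$ and $\varphi,\tilde\varphi\in L^+_\infty(D\times V)$, with $\varphi$ positive, such that $\psi_t[\varphi]=e^{\lambda_*t}\varphi$, $\langle\tilde\varphi,\psi_t[g]\rangle=e^{\lambda_*t}\langle\tilde\varphi,g\rangle$, and for some $\varepsilon>0$, $\sup_{\|g\|_\infty\le1}\|e^{-\lambda_*t}\varphi^{-1}\psi_t[g]-\langle\tilde\varphi,g\rangle\|_\infty=O(e^{-\varepsilon t})$ as $t\to\infty$. (The same existence result holds for $\psi$ with $\beta$ replaced by any potential bounded above.) Estimator. $\Psi^{\mathrm{rw}}_k[g](t,r,\upsilon)=\frac1k\sum_{i=1}^ke^{\int_0^t\beta(R^i_s,\Upsilon^i_s)ds}g(R^i_t,\Upsilon^i_t)\mathbf 1_{(t<\tau^{D,i})}$, where $(R^i,\Upsilon^i)$, $i=1,\dots,k$, are independent copies of the NRW under $\mathbf{P}_{(r,\upsilon)}$ with exit times $\tau^{D,i}$. Constant. $\kappa_{[0]}=\kappa_{[0]}(g,r,\upsilon)>0$ is a constant not depending on $t,k$; with $C_{[0]}=\langle\tilde\varphi,g\rangle\varphi(r,\upsilon)$, if $C_{[0]}\ne1$ it can be taken as $\kappa_{[0]}=2[\log(C_{[0]})e^{\lambda_*}]^2+\eta$ for any $\eta>0$.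 *)

theory Defs
  imports "HOL-Probability.Probability"
begin

type_synonym vec3 = "real ^ 3"

section \<open>Smooth domains\<close>

text \<open>\<open>ck_on k U f\<close>: all partial derivatives of \<open>f\<close> of order at most \<open>k\<close> exist and are continuous
  on the open set \<open>U\<close>.\<close>

primrec ck_on :: "nat \<Rightarrow> 'a::euclidean_space set \<Rightarrow> ('a \<Rightarrow> real) \<Rightarrow> bool" where
  "ck_on 0 U f \<longleftrightarrow> continuous_on U f"
| "ck_on (Suc k) U f \<longleftrightarrow> f differentiable_on U \<and>
     (\<forall>b\<in>Basis. ck_on k U (\<lambda>x. frechet_derivative f (at x) b))"

text \<open>The boundary is \<open>C\<^sup>\<infinity>\<close>, and the set lies locally on one side of it: near every boundary point the
  set is the negative side of a smooth defining function whose gradient does not vanish there.\<close>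

definition smooth_domain :: "'a::euclidean_space set \<Rightarrow> bool" where
  "smooth_domain D \<longleftrightarrow> (\<forall>x\<in>frontier D. \<exists>U \<rho>. open U \<and> x \<in> U \<and> (\<forall>k. ck_on k U \<rho>) \<and>
     frechet_derivative \<rho> (at x) \<noteq> (\<lambda>_. 0) \<and> D \<inter> U = {y \<in> U. \<rho> y < (0::real)})"


section \<open>The physical data and the standing assumptions\<close>

record neutron_system =
  domain :: "vec3 set"
  v_min :: real
  v_max :: real
  sigma_s :: "vec3 \<Rightarrow> vec3 \<Rightarrow> real"
  sigma_f :: "vec3 \<Rightarrow> vec3 \<Rightarrow> real"
  pi_s :: "vec3 \<Rightarrow> vec3 \<Rightarrow> vec3 \<Rightarrow> real"
  pi_f :: "vec3 \<Rightarrow> vec3 \<Rightarrow> vec3 \<Rightarrow> real"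
  n_max :: real

definition velocities :: "neutron_system \<Rightarrow> vec3 set" where
  "velocities N = {v. v_min N \<le> norm v \<and> norm v \<le> v_max N}"

text \<open>Functions on \<open>D \<times> V\<close> and \<open>D \<times> V \<times> V\<close> are represented by total functions of which only the values
  on these sets matter; accordingly measurability is required on the restricted Borel space only.\<close>

definition standing_assumptions :: "neutron_system \<Rightarrow> bool" where
  "standing_assumptions N \<longleftrightarrow>
    (let D = domain N; V = velocities N;
         \<sigma>\<^sub>s = sigma_s N; \<sigma>\<^sub>f = sigma_f N; \<pi>\<^sub>s = pi_s N; \<pi>\<^sub>f = pi_f N
     in
      D \<noteq> {} \<and> open D \<and> smooth_domain D \<and> bounded D \<and> convex D \<and>
      0 < v_min N \<and> v_min N < v_max N \<and>
      (\<lambda>(r, v). \<sigma>\<^sub>s r v) \<in> borel_measurable (restrict_space borel (D \<times> V)) \<and>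
      (\<lambda>(r, v). \<sigma>\<^sub>f r v) \<in> borel_measurable (restrict_space borel (D \<times> V)) \<and>
      (\<lambda>(r, v, v'). \<pi>\<^sub>s r v v') \<in> borel_measurable (restrict_space borel (D \<times> V \<times> V)) \<and>
      (\<lambda>(r, v, v'). \<pi>\<^sub>f r v v') \<in> borel_measurable (restrict_space borel (D \<times> V \<times> V)) \<and>
      (\<forall>r\<in>D. \<forall>v\<in>V. 0 \<le> \<sigma>\<^sub>s r v \<and> 0 \<le> \<sigma>\<^sub>f r v) \<and>
      (\<forall>r\<in>D. \<forall>v\<in>V. \<forall>v'\<in>V. 0 \<le> \<pi>\<^sub>s r v v' \<and> 0 \<le> \<pi>\<^sub>f r v v') \<and>
      (\<forall>r\<in>D. \<forall>v\<in>V. (LINT v':V|lborel. \<pi>\<^sub>s r v v') = 1) \<and>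
      (\<exists>c. (\<forall>r\<in>D. \<forall>v\<in>V. \<sigma>\<^sub>s r v \<le> c \<and> \<sigma>\<^sub>f r v \<le> c) \<and>
           (\<forall>r\<in>D. \<forall>v\<in>V. \<forall>v'\<in>V. \<pi>\<^sub>s r v v' \<le> c \<and> \<pi>\<^sub>f r v v' \<le> c)) \<and>
      0 < (INF (r, v, v')\<in>D \<times> V \<times> V. \<sigma>\<^sub>s r v * \<pi>\<^sub>s r v v' + \<sigma>\<^sub>f r v * \<pi>\<^sub>f r v v') \<and>
      (\<exists>c \<rho>. 0 < \<rho> \<and> closure (ball c \<rho>) \<subseteq> D \<and>
         0 < (INF (r, v, v')\<in>ball c \<rho> \<times> V \<times> V. \<sigma>\<^sub>f r v * \<pi>\<^sub>f r v v')) \<and>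
      1 < n_max N \<and>
      (\<forall>r\<in>D. \<forall>v\<in>V. (LINT v':V|lborel. \<pi>\<^sub>f r v v') \<le> n_max N))"

definition Linf_plus :: "neutron_system \<Rightarrow> (vec3 \<Rightarrow> vec3 \<Rightarrow> real) set" where
  "Linf_plus N = {g.
     (\<lambda>(r, v). g r v) \<in> borel_measurable (restrict_space borel (domain N \<times> velocities N)) \<and>
     (\<forall>r\<in>domain N. \<forall>v\<in>velocities N. 0 \<le> g r v) \<and>
     (\<exists>c. \<forall>r\<in>domain N. \<forall>v\<in>velocities N. g r v \<le> c)}"

definition pairing :: "neutron_system \<Rightarrow> (vec3 \<Rightarrow> vec3 \<Rightarrow> real) \<Rightarrow> (vec3 \<Rightarrow> vec3 \<Rightarrow> real) \<Rightarrow> real" where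
  "pairing N f g = (LINT (r, v):(domain N \<times> velocities N)|lborel. f r v * g r v)"

definition beta :: "neutron_system \<Rightarrow> vec3 \<Rightarrow> vec3 \<Rightarrow> real" where
  "beta N r v = sigma_f N r v * ((LINT v':velocities N|lborel. pi_f N r v v') - 1)"

definition beta_sup :: "neutron_system \<Rightarrow> real" where
  "beta_sup N = (SUP (r, v)\<in>domain N \<times> velocities N. beta N r v)"

definition beta_inf :: "neutron_system \<Rightarrow> real" where
  "beta_inf N = (INF (r, v)\<in>domain N \<times> velocities N. beta N r v)"


section \<open>The neutron random walk\<close>

text \<open>Since \<open>\<pi>(r, v, \<cdot>)\<close> is a probability density, integrating \<open>\<alpha> \<pi> = \<sigma>\<^sub>s \<pi>\<^sub>s + \<sigma>\<^sub>f \<pi>\<^sub>f\<close> over \<open>V\<close> determines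
  \<open>\<alpha>\<close>, and then \<open>\<pi>\<close>. Outside the domain the cross-sections are not given; there the walk is continued
  with unit rate and uniform scattering, so that it is defined for all times. As everything below is
  stopped at the exit time from the domain, this choice has no effect.\<close>

definition alpha :: "neutron_system \<Rightarrow> vec3 \<Rightarrow> vec3 \<Rightarrow> real" where
  "alpha N r v =
     (if r \<in> domain N
      then LINT v':velocities N|lborel.
             sigma_s N r v * pi_s N r v v' + sigma_f N r v * pi_f N r v v'
      else 1)"

definition pi_walk :: "neutron_system \<Rightarrow> vec3 \<Rightarrow> vec3 \<Rightarrow> vec3 \<Rightarrow> real" where
  "pi_walk N r v v' =
     (if r \<in> domain N
      then (sigma_s N r v * pi_s N r v v' + sigma_f N r v * pi_f N r v v') / alpha N r v
      else 1 / measure lborel (velocities N))"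

text \<open>The walk is determined by its skeleton: the sequence of triples (scattering time, position at
  that time, velocity just after it), the first one being \<open>(0, r, v)\<close>.\<close>

type_synonym event = "real \<times> vec3 \<times> vec3"

definition event_space :: "neutron_system \<Rightarrow> event measure" where
  "event_space N = borel \<Otimes>\<^sub>M borel \<Otimes>\<^sub>M restrict_space borel (velocities N)"

text \<open>From \<open>(a, r, v)\<close> the pair (waiting time \<open>u\<close>, new velocity \<open>v'\<close>) has joint density
  \<open>exp (- \<integral>\<^sub>0\<^sup>u \<alpha>(r + w v, v) dw) \<alpha>(r + u v, v) \<pi>(r + u v, v, v')\<close>.\<close>

definition next_event :: "neutron_system \<Rightarrow> event \<Rightarrow> event measure" where
  "next_event N = (\<lambda>(a, r, v).
     distr
       (density (lborel \<Otimes>\<^sub>M restrict_space lborel (velocities N))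
         (\<lambda>(u, v'). ennreal (indicator {0..} u *
            exp (- (LINT w:{0..u}|lborel. alpha N (r + w *\<^sub>R v) v)) *
            alpha N (r + u *\<^sub>R v) v * pi_walk N (r + u *\<^sub>R v) v v')))
       (event_space N)
       (\<lambda>(u, v'). (a + u, r + u *\<^sub>R v, v')))"

definition event_kernel ::
  "neutron_system \<Rightarrow> vec3 \<Rightarrow> vec3 \<Rightarrow> nat \<Rightarrow> (nat \<Rightarrow> event) \<Rightarrow> event measure" where
  "event_kernel N r v n \<omega> =
     (case n of 0 \<Rightarrow> return (event_space N) (0, r, v) | Suc m \<Rightarrow> next_event N (\<omega> m))"

text \<open>The law of the skeleton of the walk started from \<open>(r, v)\<close>, given by the Ionescu-Tulcea extension
  theorem. (Outside its locale, the projective limit has to be written with all its parameters.) The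
  law is completed, so that the values of path functionals on the null set of degenerate skeletons
  (scattering times not increasing from 0 to \<open>\<infinity>\<close>) do not affect their measurability.\<close>

definition walk_law :: "neutron_system \<Rightarrow> vec3 \<Rightarrow> vec3 \<Rightarrow> (nat \<Rightarrow> event) measure" where
  "walk_law N r v =
     completion (projective_family.lim UNIV
       (Ionescu_Tulcea.CI (event_kernel N r v) (\<lambda>_. event_space N)) (\<lambda>_. event_space N))"

text \<open>The last event at or before time \<open>t\<close>.\<close>

definition last_event :: "(nat \<Rightarrow> event) \<Rightarrow> real \<Rightarrow> event" where
  "last_event \<omega> t = \<omega> (LEAST n. t < fst (\<omega> (Suc n)))"

definition walk_pos :: "(nat \<Rightarrow> event) \<Rightarrow> real \<Rightarrow> vec3" where
  "walk_pos \<omega> t = (case last_event \<omega> t of (a, r, v) \<Rightarrow> r + (t - a) *\<^sub>R v)"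

definition walk_vel :: "(nat \<Rightarrow> event) \<Rightarrow> real \<Rightarrow> vec3" where
  "walk_vel \<omega> t = (case last_event \<omega> t of (a, r, v) \<Rightarrow> v)"

definition exit_time :: "neutron_system \<Rightarrow> (nat \<Rightarrow> event) \<Rightarrow> ereal" where
  "exit_time N \<omega> = (INF t\<in>{t. 0 < t \<and> walk_pos \<omega> t \<notin> domain N}. ereal t)"

definition weight ::
  "neutron_system \<Rightarrow> real \<Rightarrow> (vec3 \<Rightarrow> vec3 \<Rightarrow> real) \<Rightarrow> (nat \<Rightarrow> event) \<Rightarrow> real" where
  "weight N t g \<omega> =
     exp (LINT s:{0..t}|lborel. beta N (walk_pos \<omega> s) (walk_vel \<omega> s)) *
     g (walk_pos \<omega> t) (walk_vel \<omega> t) * of_bool (ereal t < exit_time N \<omega>)"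

definition psi ::
  "neutron_system \<Rightarrow> real \<Rightarrow> (vec3 \<Rightarrow> vec3 \<Rightarrow> real) \<Rightarrow> vec3 \<Rightarrow> vec3 \<Rightarrow> real" where
  "psi N t g r v = (LINT \<omega>|walk_law N r v. weight N t g \<omega>)"


section \<open>The leading eigen-triple and the Monte Carlo estimator\<close>

text \<open>The last conjunct writes out that the double supremum, over \<open>g\<close> in the unit ball and over
  \<open>D \<times> V\<close>, is \<open>O(exp (- \<epsilon> t))\<close> as \<open>t \<rightarrow> \<infinity>\<close>.\<close>

definition leading_eigentriple ::
  "neutron_system \<Rightarrow> real \<Rightarrow> (vec3 \<Rightarrow> vec3 \<Rightarrow> real) \<Rightarrow> (vec3 \<Rightarrow> vec3 \<Rightarrow> real) \<Rightarrow> bool" where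
  "leading_eigentriple N lam \<phi> \<phi>' \<longleftrightarrow>
     \<phi> \<in> Linf_plus N \<and> \<phi>' \<in> Linf_plus N \<and>
     (\<forall>r\<in>domain N. \<forall>v\<in>velocities N. 0 < \<phi> r v) \<and>
     (\<forall>t\<ge>0. \<forall>r\<in>domain N. \<forall>v\<in>velocities N. psi N t \<phi> r v = exp (lam * t) * \<phi> r v) \<and>
     (\<forall>t\<ge>0. \<forall>g\<in>Linf_plus N. pairing N \<phi>' (psi N t g) = exp (lam * t) * pairing N \<phi>' g) \<and>
     (\<exists>\<epsilon>>0. \<exists>c. \<forall>\<^sub>F t in at_top. \<forall>g\<in>Linf_plus N.
        (\<forall>r\<in>domain N. \<forall>v\<in>velocities N. g r v \<le> 1) \<longrightarrow>
        (\<forall>r\<in>domain N. \<forall>v\<in>velocities N.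
           \<bar>exp (- lam * t) * psi N t g r v / \<phi> r v - pairing N \<phi>' g\<bar> \<le> c * exp (- \<epsilon> * t)))"

text \<open>\<open>\<omega> 0, \<dots>, \<omega> (k - 1)\<close> are the skeletons of the \<open>k\<close> copies of the walk; they are independent under
  \<open>copies_law\<close>.\<close>

definition copies_law ::
  "neutron_system \<Rightarrow> nat \<Rightarrow> vec3 \<Rightarrow> vec3 \<Rightarrow> (nat \<Rightarrow> nat \<Rightarrow> event) measure" where
  "copies_law N k r v = PiM {..<k} (\<lambda>_. walk_law N r v)"

definition Psi_rw ::
  "neutron_system \<Rightarrow> nat \<Rightarrow> (vec3 \<Rightarrow> vec3 \<Rightarrow> real) \<Rightarrow> real \<Rightarrow> (nat \<Rightarrow> nat \<Rightarrow> event) \<Rightarrow> real" where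
  "Psi_rw N k g t \<omega> = (\<Sum>i<k. weight N t g (\<omega> i)) / real k"

definition mean_square_error ::
  "neutron_system \<Rightarrow> nat \<Rightarrow> (vec3 \<Rightarrow> vec3 \<Rightarrow> real) \<Rightarrow> real \<Rightarrow> vec3 \<Rightarrow> vec3 \<Rightarrow> real \<Rightarrow> real" where
  "mean_square_error N k g t r v x =
     (LINT \<omega>|copies_law N k r v. (Psi_rw N k g t \<omega> powr (1 / t) - x)\<^sup>2)"

end

theory Submission
  imports Defs
begin

text \<open>
  The choice \<open>\<lambda>\<^sub>1 = \<lambda>\<^sub>* + sup \<beta>\<close> works. Up to the exit time the weight of a path is at most
  \<open>exp (t sup \<beta>) \<parallel>g\<parallel>\<close>, so its second moment is at most that bound times the first moment
  \<open>m = \<psi>\<^sub>t[g](r, v)\<close>, and \<open>exp (- \<lambda>\<^sub>* t) m\<close> tends to \<open>C\<^sub>0 > 0\<close>. Since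
  \<open>\<bar>x\<^sup>p - m\<^sup>p\<bar> \<le> m\<^sup>p\<^sup>-\<^sup>1 \<bar>x - m\<bar>\<close> for \<open>0 < p \<le> 1\<close>, the variance of the sample mean controls the random part of
  the error, while the bias \<open>m\<^sup>1\<^sup>/\<^sup>t - exp \<lambda>\<^sub>*\<close> is \<open>exp \<lambda>\<^sub>* ln C\<^sub>0 / t\<close> to first order. The inequality
  \<open>\<lambda>\<^sub>* \<le> sup \<beta>\<close> comes from \<open>exp (\<lambda>\<^sub>* t) \<phi> = \<psi>\<^sub>t[\<phi>] \<le> exp (t sup \<beta>) \<parallel>\<phi>\<parallel>\<close>.
\<close>

section \<open>Real analysis\<close>

text \<open>By homogeneity only \<open>z = x / y\<close> matters: for \<open>0 < p \<le> 1\<close>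
  the power \<open>z powr p\<close> lies between 1 and \<open>z\<close>, hence is no farther from 1
  than \<open>z\<close> is. The constant depends on \<open>y\<close> alone, so \<open>x\<close> may
  come arbitrarily close to 0.\<close>

lemma abs_powr_diff_le:
  fixes x y p :: real
  assumes "0 \<le> x" "0 < y" "0 < p" "p \<le> 1"
  shows "\<bar>x powr p - y powr p\<bar> \<le> y powr (p - 1) * \<bar>x - y\<bar>"
proof -
  define z where "z = x / y"
  have z: "0 \<le> z" "x = z * y" using assms by (auto simp: z_def)
  have 1: "\<bar>z powr p - 1\<bar> \<le> \<bar>z - 1\<bar>"
  proof (cases "z \<ge> 1")
    case True
    then have "z powr p \<le> z powr 1" "1 \<le> z powr p" using assms
      by (intro powr_mono ge_one_powr_ge_zero; simp)+
    then show ?thesis using True by simp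
  next
    case False
    then have "z powr 1 \<le> z powr p" "z powr p \<le> 1" using assms z
      by (intro powr_mono' powr_le1; simp)+
    then show ?thesis using False z by simp
  qed
  have "x powr p - y powr p = y powr p * (z powr p - 1)"
    using z assms by (simp add: powr_mult algebra_simps)
  then have "\<bar>x powr p - y powr p\<bar> = y powr p * \<bar>z powr p - 1\<bar>"
    by (simp add: abs_mult)
  also have "\<dots> \<le> y powr p * \<bar>z - 1\<bar>" by (intro mult_left_mono 1) auto
  also have "\<dots> = y powr (p - 1) * \<bar>x - y\<bar>"
    using assms by (simp add: powr_diff z_def field_simps abs_mult flip: abs_mult_pos)
  finally show ?thesis .
qed

text \<open>The tangent inequality \<open>1 + x \<le> exp x\<close> is used at \<open>x = -h\<close>
  for nonnegative \<open>h\<close> and at \<open>x = h\<close> for negative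
  \<open>h\<close>.\<close>

lemma abs_exp_minus_one_le: "\<bar>exp h - 1\<bar> \<le> \<bar>h\<bar> * exp \<bar>h\<bar>" for h :: real
proof (cases "h \<ge> 0")
  case True
  have "(1 - h) * exp h \<le> exp (-h) * exp h"
    using exp_ge_add_one_self[of "-h"] by (intro mult_right_mono) auto
  then have "exp h - 1 \<le> h * exp h" by (simp add: exp_minus_inverse algebra_simps flip: exp_add)
  then show ?thesis using True by simp
next
  case False
  have "1 - exp h \<le> - h" using exp_ge_add_one_self[of h] by linarith
  also have "\<dots> \<le> -h * exp (-h)" using False mult_left_mono[of 1 "exp (-h)" "-h"] by simp
  finally show ?thesis using False by simp
qed

text \<open>The root equals \<open>exp l * exp (ln (C t) / t)\<close>, so its error is
  \<open>exp l * ln C0 / t\<close> to leading order. The slack \<open>\<eta>\<close> pays for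
  replacing \<open>C t\<close> by its limit and for the higher-order terms. The factor 2 anticipates
  the splitting \<open>(a + b)^2 \<le> 2 * a^2 + 2 * b^2\<close>.\<close>

lemma eventually_root_error_le:
  fixes C :: "real \<Rightarrow> real"
  assumes C: "(C \<longlongrightarrow> C0) at_top" and C0: "0 < C0" and \<eta>: "0 < \<eta>"
  shows "\<forall>\<^sub>F t in at_top. 2 * ((exp (l * t) * C t) powr (1 / t) - exp l)\<^sup>2
           \<le> (2 * (ln C0 * exp l)\<^sup>2 + \<eta>) / t\<^sup>2"
proof -
  have lnC: "((\<lambda>t. ln (C t)) \<longlongrightarrow> ln C0) at_top" using C C0 by (auto intro: tendsto_ln)
  have "((\<lambda>t. \<bar>ln (C t)\<bar> / t) \<longlongrightarrow> 0) at_top"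
    by (intro tendsto_divide_0[OF tendsto_rabs[OF lnC]] filterlim_at_top_imp_at_infinity filterlim_ident)
  \<comment> \<open>This is \<open>t^2\<close> times the bound obtained below for the doubled
    squared error; its limit lies strictly below the target numerator because \<open>\<eta>\<close>
    is positive.\<close>
  then have "((\<lambda>t. 2 * (exp l * (\<bar>ln (C t)\<bar> * exp (\<bar>ln (C t)\<bar> / t)))\<^sup>2)
      \<longlongrightarrow> 2 * (exp l * (\<bar>ln C0\<bar> * exp 0))\<^sup>2) at_top"
    by (intro tendsto_intros lnC)
  then have "\<forall>\<^sub>F t in at_top. 2 * (exp l * (\<bar>ln (C t)\<bar> * exp (\<bar>ln (C t)\<bar> / t)))\<^sup>2
      < 2 * (ln C0 * exp l)\<^sup>2 + \<eta>"
    by (rule order_tendstoD(2)) (use \<eta> in \<open>simp add: power_mult_distrib mult.commute\<close>)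
  moreover have "\<forall>\<^sub>F t in at_top. 0 < C t" using C C0 by (rule order_tendstoD)
  ultimately show ?thesis using eventually_gt_at_top[of 0]
  proof eventually_elim
    case (elim t)
    have "(exp (l * t) * C t) powr (1 / t) = exp l * exp (ln (C t) / t)"
      using elim by (simp add: powr_def ln_mult exp_add[symmetric] field_simps)
    then have "\<bar>(exp (l * t) * C t) powr (1 / t) - exp l\<bar> = exp l * \<bar>exp (ln (C t) / t) - 1\<bar>"
      by (simp add: abs_mult right_diff_distrib[symmetric] flip: abs_mult_pos' )
        (metis abs_exp_cancel abs_mult mult.right_neutral right_diff_distrib)
    also have "\<dots> \<le> exp l * (\<bar>ln (C t) / t\<bar> * exp \<bar>ln (C t) / t\<bar>)"
      by (intro mult_left_mono abs_exp_minus_one_le) auto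
    also have "\<dots> = exp l * (\<bar>ln (C t)\<bar> * exp (\<bar>ln (C t)\<bar> / t)) / t" using elim by simp
    finally have "((exp (l * t) * C t) powr (1 / t) - exp l)\<^sup>2
      \<le> (exp l * (\<bar>ln (C t)\<bar> * exp (\<bar>ln (C t)\<bar> / t)) / t)\<^sup>2"
      by (subst abs_le_square_iff[symmetric]) (use elim in simp)
    then have "2 * ((exp (l * t) * C t) powr (1 / t) - exp l)\<^sup>2
      \<le> 2 * (exp l * (\<bar>ln (C t)\<bar> * exp (\<bar>ln (C t)\<bar> / t)))\<^sup>2 / t\<^sup>2" by (simp add: power_divide)
    also have "\<dots> \<le> (2 * (ln C0 * exp l)\<^sup>2 + \<eta>) / t\<^sup>2"
      using elim by (intro divide_right_mono) auto
    finally show ?case .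
  qed
qed

text \<open>As \<open>a\<close> is only measurable, the fundamental theorem of calculus does not apply to
  \<open>A u = \<integral>\<^sub>0\<^sup>u a\<close>. Instead, \<open>G u = \<integral>\<^sub>0\<^sup>u a exp (- A) + exp (- A u)\<close> satisfies
  \<open>\<bar>G t - G s\<bar> \<le> c\<^sup>2 (t - s)\<^sup>2\<close>, hence it is constant.\<close>

lemma survival_integral:
  fixes a :: "real \<Rightarrow> real"
  assumes [measurable]: "a \<in> borel_measurable borel"
    and a: "\<And>u. 0 \<le> a u" "\<And>u. a u \<le> c" and a1: "\<And>u. T \<le> u \<Longrightarrow> a u = 1"
  shows "(\<integral>\<^sup>+u. ennreal (indicator {0..} u * exp (- (LINT w:{0..u}|lborel. a w)) * a u) \<partial>lborel) = 1"
proof -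
  define A where "A u = (LINT w:{0..u}|lborel. a w)" for u
  define f where "f u = exp (- A u) * a u" for u
  define F where "F u = (LINT w:{0..u}|lborel. f w)" for u
  have c: "0 \<le> c" using a[of 0] by simp
  have int: "set_integrable lborel I h"
    if "h \<in> borel_measurable borel" "\<And>u. u \<in> I \<Longrightarrow> \<bar>h u\<bar> \<le> B" "I \<in> sets borel" "bounded I"
    for h :: "real \<Rightarrow> real" and I B
    unfolding set_integrable_def using that emeasure_bounded_finite[of I]
    by (intro integrableI_bounded_set_indicator[where B=B]) (auto intro!: AE_I2)
  have int_a: "set_integrable lborel {s..t} a" "set_integrable lborel {s<..t} a" for s t
    by (rule int[where B=c]; use a in \<open>auto simp: bounded_Ioc\<close>)+
  have diff: "(LINT w:{0..t}|lborel. h w) - (LINT w:{0..s}|lborel. h w) = (LINT w:{s<..t}|lborel. h w)"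
    if "0 \<le> s" "s \<le> t" "set_integrable lborel {0..t} h" for s t and h :: "real \<Rightarrow> real"
  proof -
    have "{0..t} = {0..s} \<union> {s<..t}" using that by auto
    moreover have "set_integrable lborel {0..s} h" "set_integrable lborel {s<..t} h"
      using that by (auto intro: set_integrable_subset)
    moreover have "{0..s} \<inter> {s<..t} = {}" by auto
    ultimately show ?thesis
      by (simp only: set_integral_Un)
  qed
  have dA: "A t - A s = (LINT w:{s<..t}|lborel. a w)" if "0 \<le> s" "s \<le> t" for s t
    unfolding A_def using that by (intro diff int_a)
  have null: "(LINT w:{0..u}|lborel. h w) = 0" if "u \<le> 0" for u and h :: "real \<Rightarrow> real"
    unfolding set_lebesgue_integral_def using AE_lborel_singleton[of "0::real"]
    by (intro integral_eq_zero_AE, eventually_elim) (use that in \<open>auto split: split_indicator\<close>)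
  then have A0: "A u = 0" if "u \<le> 0" for u using that by (simp add: A_def)
  have A_le: "A t - A s \<le> c * (t - s)" "0 \<le> A t - A s" if "0 \<le> s" "s \<le> t" for s t
  proof -
    have "(LINT w:{s<..t}|lborel. a w) \<le> (LINT w:{s<..t}|lborel. c)"
      by (rule set_integral_mono) (use a int_a int[of "\<lambda>_. c" _ c] c in \<open>auto simp: bounded_Ioc\<close>)
    also have "(LINT w:{s<..t}|lborel. c) = c * (t - s)"
      using that by (simp add: set_lebesgue_integral_def)
    finally show "A t - A s \<le> c * (t - s)" using dA[OF that] by simp
    show "0 \<le> A t - A s" using that dA a by (auto simp: set_lebesgue_integral_def)
  qed
  \<comment> \<open>\<open>A\<close> vanishes on the negative half-line, so monotonicity on the
    positive one extends to the whole line. Borel measurability of \<open>A\<close> then comes from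
    monotonicity.\<close>
  have "mono A"
  proof
    fix s t :: real assume "s \<le> t"
    moreover have "A (max u 0) = A u" for u using A0[of u] A0[of 0] by (simp add: max_def)
    ultimately show "A s \<le> A t" using A_le(2)[of "max s 0" "max t 0"] by simp
  qed
  then have [measurable]: "A \<in> borel_measurable borel" by (rule borel_measurable_mono)
  have A_nonneg: "0 \<le> A u" for u using \<open>mono A\<close>[THEN monoD, of "min 0 u" u] A0[of "min 0 u"] by simp
  have [measurable]: "f \<in> borel_measurable borel" unfolding f_def by measurable
  have f: "0 \<le> f u" "f u \<le> c" for u
    using a[of u] A_nonneg[of u] mult_mono[of "exp (- A u)" 1 "a u" c] by (auto simp: f_def)
  have int_f: "set_integrable lborel {s..t} f" "set_integrable lborel {s<..t} f" for s t
    by (rule int[where B=c]; use f in \<open>auto simp: bounded_Ioc\<close>)+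
  have dF: "F t - F s = (LINT w:{s<..t}|lborel. f w)" if "0 \<le> s" "s \<le> t" for s t
    unfolding F_def using that by (intro diff int_f)
  define G where "G u = F u + exp (- A u)" for u
  have G_le: "\<bar>G t - G s\<bar> \<le> c\<^sup>2 * (t - s)\<^sup>2" if st: "0 \<le> s" "s \<le> t" for s t
  proof -
    have "F t - F s \<le> (LINT w:{s<..t}|lborel. exp (- A s) * a w)"
      unfolding dF[OF st] using st
      by (intro set_integral_mono int_f set_integrable_mult_right int_a)
         (use \<open>mono A\<close>[THEN monoD] a in \<open>auto simp: f_def intro!: mult_right_mono\<close>)
    then have F1: "F t - F s \<le> exp (- A s) * (A t - A s)" using dA[OF st] by simp
    have "(LINT w:{s<..t}|lborel. exp (- A t) * a w) \<le> F t - F s"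
      unfolding dF[OF st] using st
      by (intro set_integral_mono int_f set_integrable_mult_right int_a)
         (use \<open>mono A\<close>[THEN monoD] a in \<open>auto simp: f_def intro!: mult_right_mono\<close>)
    then have F2: "exp (- A t) * (A t - A s) \<le> F t - F s" using dA[OF st] by simp
    let ?d = "A t - A s"
    have d: "0 \<le> ?d" "?d \<le> c * (t - s)" using A_le[OF st] by auto
    have E: "exp (- A s) = exp (- A t) * exp ?d" by (simp flip: exp_add)
    have E2: "exp (- A t) = exp (- A s) * exp (- ?d)" by (simp flip: exp_add)
    have "exp (- A t) * (1 + ?d) \<le> exp (- A s)"
      unfolding E by (intro mult_left_mono exp_ge_add_one_self) auto
    then have E3: "exp (- A t) * ?d \<le> exp (- A s) - exp (- A t)" by (simp add: algebra_simps)
    have "exp (- A s) * (1 - ?d) \<le> exp (- A t)"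
      unfolding E2
      by (intro mult_left_mono)
        (use exp_ge_add_one_self[of "- ?d"] in \<open>simp_all only: exp_ge_zero diff_conv_add_uminus\<close>)
    then have E4: "exp (- A s) - exp (- A t) \<le> exp (- A s) * ?d" by (simp add: algebra_simps)
    have "exp (- A s) * ?d \<le> 1 * ?d" using d A_nonneg[of s] by (intro mult_right_mono) auto
    with E4 have E5: "exp (- A s) - exp (- A t) \<le> ?d" by simp
    \<comment> \<open>The increment of \<open>F\<close> and the drop of \<open>exp (- A)\<close>
      both lie between \<open>exp (- A t) * ?d\<close> and \<open>exp (- A s) * ?d\<close>, so they
      differ by at most the length of this interval.\<close>
    have "\<bar>G t - G s\<bar> \<le> (exp (- A s) - exp (- A t)) * ?d"
      using F1 F2 E3 E4 by (simp add: G_def algebra_simps abs_le_iff)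
    also have "\<dots> \<le> ?d * ?d" using E5 d by (intro mult_right_mono) auto
    also have "\<dots> \<le> (c * (t - s)) * (c * (t - s))" using d by (intro mult_mono) auto
    finally show ?thesis by (simp add: power2_eq_square algebra_simps)
  qed
  have G_le': "\<bar>G t - G s\<bar> \<le> c\<^sup>2 * (t - s)\<^sup>2" if "0 \<le> s" "0 \<le> t" for s t
    using G_le[of s t] G_le[of t s] that by (cases "s \<le> t") (auto simp: abs_minus_commute power2_commute)
  have "\<exists>k. \<forall>x\<in>{0..}. G x = k"
  proof (rule has_field_derivative_zero_constant)
    fix x :: real assume x: "x \<in> {0..}"
    have "((\<lambda>y. (G y - G x) / (y - x)) \<longlongrightarrow> 0) (at x within {0..})"
    proof (rule Lim_null_comparison)
      show "\<forall>\<^sub>F y in at x within {0..}. norm ((G y - G x) / (y - x)) \<le> c\<^sup>2 * \<bar>y - x\<bar>"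
        unfolding eventually_at_filter
      proof (intro always_eventually allI impI)
        fix y :: real assume "y \<noteq> x" "y \<in> {0..}"
        then show "norm ((G y - G x) / (y - x)) \<le> c\<^sup>2 * \<bar>y - x\<bar>"
          using G_le'[of x y] x by (simp add: field_simps power2_eq_square abs_mult)
      qed
      show "((\<lambda>y. c\<^sup>2 * \<bar>y - x\<bar>) \<longlongrightarrow> 0) (at x within {0..})"
        by (auto intro!: tendsto_eq_intros)
    qed
    then show "(G has_field_derivative 0) (at x within {0..})"
      by (simp add: has_field_derivative_iff)
  qed simp
  moreover have "F 0 = 0" unfolding F_def by (rule null) simp
  ultimately have F: "F u = 1 - exp (- A u)" if "0 \<le> u" for u
  proof -
    have "G u = G 0" using \<open>\<exists>k. \<forall>x\<in>{0..}. G x = k\<close> that by auto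
    then show ?thesis using A0[of 0] \<open>F 0 = 0\<close> by (simp add: G_def)
  qed
  \<comment> \<open>Beyond \<open>T'\<close> the rate is 1, so \<open>A\<close> grows at least
    linearly and the survival function tends to 0: no mass escapes to infinity. The maximum with 0
    keeps the interval inside the half-line where increments of \<open>A\<close> are
    integrals.\<close>
  define T' where "T' = max T 0"
  have "A u \<ge> u - T'" if "T' \<le> u" for u
  proof -
    have "(LINT w:{T'<..u}|lborel. 1) = (LINT w:{T'<..u}|lborel. a w)"
      by (rule set_lebesgue_integral_cong) (auto simp: a1 T'_def)
    moreover have "(LINT w:{T'<..u}|lborel. 1) = u - T'"
      using that by (simp add: set_lebesgue_integral_def)
    moreover have "A u - A T' = (LINT w:{T'<..u}|lborel. a w)"
      using that by (intro dA) (auto simp: T'_def)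
    ultimately show ?thesis using A_nonneg[of T'] by linarith
  qed
  moreover have "filterlim (\<lambda>u. - T' + u) at_top at_top"
    by (rule filterlim_tendsto_add_at_top[OF tendsto_const filterlim_ident])
  moreover have "\<forall>\<^sub>F u in at_top. - T' + u \<le> A u"
    using calculation(1) by (intro eventually_at_top_linorderI[of T']) simp
  ultimately have "filterlim A at_top at_top"
    by (metis filterlim_at_top_mono)
  then have "((\<lambda>u. exp (- A u)) \<longlongrightarrow> 0) at_top"
    by (intro filterlim_compose[OF exp_at_bot] filterlim_compose[OF filterlim_uminus_at_bot_at_top])
  then have "((\<lambda>u. 1 - exp (- A u)) \<longlongrightarrow> 1) at_top"
    using tendsto_diff[OF tendsto_const[of 1], of "\<lambda>u. exp (- A u)" 0 at_top] by simp
  then have "(\<lambda>n. ennreal (1 - exp (- A (real n)))) \<longlonglongrightarrow> ennreal 1"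
    by (intro tendsto_ennrealI filterlim_compose[OF _ filterlim_real_sequentially])
  moreover have "ennreal (1 - exp (- A (real n))) = (\<integral>\<^sup>+u. ennreal (indicator {0..real n} u * f u) \<partial>lborel)" for n
    using F[of n] int_f[of 0 n] f unfolding F_def set_lebesgue_integral_def set_integrable_def
    by (subst nn_integral_eq_integral) auto
  moreover have "(\<lambda>n. \<integral>\<^sup>+u. ennreal (indicator {0..real n} u * f u) \<partial>lborel)
     \<longlonglongrightarrow> (\<integral>\<^sup>+u. ennreal (indicator {0..} u * f u) \<partial>lborel)"
  proof (rule nn_integral_LIMSEQ)
    show "incseq (\<lambda>n u. ennreal (indicator {0..real n} u * f u))"
      using f by (auto simp: incseq_def le_fun_def split: split_indicator)
    fix u :: real
    have "\<forall>\<^sub>F n in sequentially. ennreal (indicator {0..real n} u * f u) = ennreal (indicator {0..} u * f u)"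
      using eventually_ge_at_top[of "nat \<lceil>u\<rceil>"]
      by eventually_elim (auto split: split_indicator)
    then show "(\<lambda>n. ennreal (indicator {0..real n} u * f u)) \<longlonglongrightarrow> ennreal (indicator {0..} u * f u)"
      by (rule tendsto_eventually)
  qed measurable
  ultimately have "(\<integral>\<^sup>+u. ennreal (indicator {0..} u * f u) \<partial>lborel) = 1"
    using LIMSEQ_unique by fastforce
  then show ?thesis by (simp add: f_def A_def mult.assoc)
qed

section \<open>Independent copies\<close>

context prob_space begin

text \<open>Expanding the square of the centred sum, independence removes the off-diagonal terms,
  and the \<open>k\<close> diagonal ones give variance over \<open>k\<close>. The variance is at
  most the second moment.\<close>

lemma sample_mean_square_deviation:
  fixes X :: "'a \<Rightarrow> real"
  assumes X: "integrable M X" and X2: "integrable M (\<lambda>x. (X x)\<^sup>2)" and k: "1 \<le> k"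
  defines "\<And>\<omega>. S \<omega> \<equiv> ((\<Sum>i<k. X (\<omega> i)) / real k - expectation X)\<^sup>2"
  shows "integrable (PiM {..<k} (\<lambda>_. M)) S"
    and "integral\<^sup>L (PiM {..<k} (\<lambda>_. M)) S \<le> expectation (\<lambda>x. (X x)\<^sup>2) / real k"
proof -
  interpret P: product_prob_space "\<lambda>_::nat. M" "{..<k}" by unfold_locales
  define Y where "Y x = X x - expectation X" for x
  have Y: "integrable M Y" "integrable M (\<lambda>x. (Y x)\<^sup>2)" "expectation Y = 0"
    using X X2 by (simp_all add: Y_def[abs_def] power2_diff prob_space)
  have Y2: "expectation (\<lambda>x. (Y x)\<^sup>2) \<le> expectation (\<lambda>x. (X x)\<^sup>2)"
    using variance_eq[OF X X2] by (simp add: Y_def)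
  \<comment> \<open>\<open>f i j l\<close> is the factor at coordinate \<open>l\<close> when
    \<open>Y (\<omega> i) * Y (\<omega> j)\<close> is written as a product over all coordinates. In
    this form the integral over the product measure factorises; the diagonal case puts the square at
    one coordinate.\<close>
  define f where "f i j l = (if i = j \<and> l = i then \<lambda>x. (Y x)\<^sup>2 else if l = i \<or> l = j then Y else (\<lambda>_. 1))"
    for i j l :: nat
  have f_int: "integrable M (f i j l)" for i j l using Y by (auto simp: f_def)
  have f_prod: "(\<Prod>l<k. f i j l (\<omega> l)) = Y (\<omega> i) * Y (\<omega> j)" if "i < k" "j < k" for i j and \<omega> :: "nat \<Rightarrow> 'a"
  proof (cases "i = j")
    case True
    have "(\<Prod>l<k. f i j l (\<omega> l)) = (\<Prod>l\<in>{i}. f i j l (\<omega> l))"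
      by (rule prod.mono_neutral_right) (use that True in \<open>auto simp: f_def\<close>)
    then show ?thesis using True by (simp add: f_def power2_eq_square)
  next
    case False
    have "(\<Prod>l<k. f i j l (\<omega> l)) = (\<Prod>l\<in>{i, j}. f i j l (\<omega> l))"
      by (rule prod.mono_neutral_right) (use that False in \<open>auto simp: f_def\<close>)
    then show ?thesis using False by (simp add: f_def)
  qed
  have YY_int: "integrable (PiM {..<k} (\<lambda>_. M)) (\<lambda>\<omega>. Y (\<omega> i) * Y (\<omega> j))" if "i < k" "j < k" for i j
    using P.product_integrable_prod[of "{..<k}" "f i j"] f_int f_prod[OF that] by simp
  have YY: "(\<integral>\<omega>. Y (\<omega> i) * Y (\<omega> j) \<partial>PiM {..<k} (\<lambda>_. M)) = (if i = j then expectation (\<lambda>x. (Y x)\<^sup>2) else 0)"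
    if "i < k" "j < k" for i j
  proof -
    have "(\<integral>\<omega>. Y (\<omega> i) * Y (\<omega> j) \<partial>PiM {..<k} (\<lambda>_. M)) = (\<Prod>l<k. expectation (f i j l))"
      using P.product_integral_prod[of "{..<k}" "f i j"] f_int f_prod[OF that] by simp
    also have "\<dots> = (if i = j then expectation (\<lambda>x. (Y x)\<^sup>2) else 0)"
    proof (cases "i = j")
      case True
      have "(\<Prod>l<k. expectation (f i j l)) = (\<Prod>l\<in>{i}. expectation (f i j l))"
        by (rule prod.mono_neutral_right) (use that True in \<open>auto simp: f_def prob_space\<close>)
      then show ?thesis using True by (simp add: f_def)
    next
      case False
      then have "expectation (f i j i) = 0" using Y by (simp add: f_def)
      then show ?thesis using False that by (auto intro!: prod_zero)
    qed
    finally show ?thesis .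
  qed
  have S: "S \<omega> = (\<Sum>i<k. \<Sum>j<k. Y (\<omega> i) * Y (\<omega> j)) / (real k)\<^sup>2" for \<omega>
  proof -
    have "(\<Sum>i<k. X (\<omega> i)) / real k - expectation X = (\<Sum>i<k. Y (\<omega> i)) / real k"
      using k by (simp add: Y_def sum_subtractf field_simps)
    then show ?thesis
      by (simp add: S_def power_divide power2_eq_square sum_product)
  qed
  show "integrable (PiM {..<k} (\<lambda>_. M)) S"
    unfolding S[abs_def] by (intro integrable_divide Bochner_Integration.integrable_sum YY_int) auto
  have "(\<integral>\<omega>. (\<Sum>i<k. \<Sum>j<k. Y (\<omega> i) * Y (\<omega> j)) \<partial>PiM {..<k} (\<lambda>_. M))
      = (\<Sum>i<k. \<Sum>j<k. \<integral>\<omega>. Y (\<omega> i) * Y (\<omega> j) \<partial>PiM {..<k} (\<lambda>_. M))"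
    by (intro Bochner_Integration.integral_sum[THEN trans] sum.cong refl Bochner_Integration.integrable_sum YY_int)
      auto
  then have "integral\<^sup>L (PiM {..<k} (\<lambda>_. M)) S
      = (\<Sum>i<k. \<Sum>j<k. if i = j then expectation (\<lambda>x. (Y x)\<^sup>2) else 0) / (real k)\<^sup>2"
    unfolding S[abs_def] by (simp add: YY)
  also have "\<dots> = expectation (\<lambda>x. (Y x)\<^sup>2) / real k"
    using k by (simp add: power2_eq_square)
  also have "\<dots> \<le> expectation (\<lambda>x. (X x)\<^sup>2) / real k" using Y2 by (simp add: divide_right_mono)
  finally show "integral\<^sup>L (PiM {..<k} (\<lambda>_. M)) S \<le> expectation (\<lambda>x. (X x)\<^sup>2) / real k" .
qed

text \<open>The value \<open>m powr p\<close> is inserted between the root of the sample mean and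
  \<open>c\<close>. The random part is linearised by \<open>abs_powr_diff_le\<close> around
  \<open>m\<close> and then controlled by the variance; the bias is deterministic.\<close>

lemma sample_mean_powr_error:
  fixes X :: "'a \<Rightarrow> real"
  assumes X: "integrable M X" and X2: "integrable M (\<lambda>x. (X x)\<^sup>2)" and k: "1 \<le> k"
    and nonneg: "\<And>x. x \<in> space M \<Longrightarrow> 0 \<le> X x" and p: "0 < p" "p \<le> 1"
    and m: "m = expectation X" "0 < m"
  shows "(\<integral>\<omega>. (((\<Sum>i<k. X (\<omega> i)) / real k) powr p - c)\<^sup>2 \<partial>PiM {..<k} (\<lambda>_. M))
    \<le> 2 * (m powr (p - 1))\<^sup>2 * (expectation (\<lambda>x. (X x)\<^sup>2) / real k) + 2 * (m powr p - c)\<^sup>2"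
proof -
  let ?P = "PiM {..<k} (\<lambda>_. M)"
  interpret P: prob_space ?P by (intro prob_space_PiM prob_space_axioms)
  let ?S = "\<lambda>\<omega>. ((\<Sum>i<k. X (\<omega> i)) / real k - expectation X)\<^sup>2"
  note S = sample_mean_square_deviation[OF X X2 k]
  have "(\<integral>\<omega>. (((\<Sum>i<k. X (\<omega> i)) / real k) powr p - c)\<^sup>2 \<partial>?P)
      \<le> (\<integral>\<omega>. 2 * (m powr (p - 1))\<^sup>2 * ?S \<omega> + 2 * (m powr p - c)\<^sup>2 \<partial>?P)"
  \<comment> \<open>Only the majorant has to be integrable. It is nonnegative, so the comparison
    also covers a left-hand integral that takes the default value 0.\<close>
  proof (rule integral_mono')
    fix \<omega> assume \<omega>: "\<omega> \<in> space ?P"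
    let ?x = "(\<Sum>i<k. X (\<omega> i)) / real k"
    have "0 \<le> ?x" using nonneg \<omega> by (auto simp: space_PiM PiE_iff intro!: divide_nonneg_nonneg sum_nonneg)
    then have "\<bar>?x powr p - m powr p\<bar> \<le> \<bar>m powr (p - 1) * (?x - m)\<bar>"
      using abs_powr_diff_le[of ?x m p] p m by (simp add: abs_mult)
    then have 1: "(?x powr p - m powr p)\<^sup>2 \<le> (m powr (p - 1) * (?x - m))\<^sup>2"
      by (simp add: abs_le_square_iff)
    have "(?x powr p - c)\<^sup>2 \<le> 2 * (?x powr p - m powr p)\<^sup>2 + 2 * (m powr p - c)\<^sup>2"
      using sum_squares_bound[of "?x powr p - m powr p" "m powr p - c"]
      by (simp add: power2_eq_square algebra_simps)
    then show "(?x powr p - c)\<^sup>2 \<le> 2 * (m powr (p - 1))\<^sup>2 * ?S \<omega> + 2 * (m powr p - c)\<^sup>2"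
      using 1 by (simp add: m power_mult_distrib)
  qed (use S in simp_all)
  also have "\<dots> = 2 * (m powr (p - 1))\<^sup>2 * (\<integral>\<omega>. ?S \<omega> \<partial>?P) + 2 * (m powr p - c)\<^sup>2"
    using S by (simp add: P.prob_space)
  also have "\<dots> \<le> 2 * (m powr (p - 1))\<^sup>2 * (expectation (\<lambda>x. (X x)\<^sup>2) / real k) + 2 * (m powr p - c)\<^sup>2"
    using S(2) by (intro add_right_mono mult_left_mono) auto
  finally show ?thesis .
qed

end

section \<open>The law of the walk\<close>

text \<open>The total mass can be read off from any one marginal: the cylinder over the full space
  of coordinate 0 is the whole space of sequences.\<close>

lemma Ionescu_Tulcea_prob_space_lim:
  assumes "Ionescu_Tulcea P M"
  shows "prob_space (projective_family.lim UNIV (Ionescu_Tulcea.CI P M) M)"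
proof -
  interpret Ionescu_Tulcea P M by fact
  have "emeasure PF.lim (PF.emb UNIV {0} (space (PiM {0} M))) = emeasure (CI {0}) (space (PiM {0} M))"
    by (rule lim) auto
  also have "PF.emb UNIV {0} (space (PiM {0} M)) = space PF.lim"
    by (auto simp: prod_emb_def space_PiM PiE_iff)
  also have "emeasure (CI {0}) (space (PiM {0} M)) = 1"
    using prob_space.emeasure_space_1[OF PF.prob_space_P[of "{0}"]] PF.space_P[of "{0}"] by simp
  finally show ?thesis by (rule prob_spaceI)
qed

lemma measurable_id_restrict_space_borel [measurable]: "(\<lambda>x. x) \<in> restrict_space borel A \<rightarrow>\<^sub>M borel"
  by (simp add: measurable_restrict_space1)

section \<open>Domain, velocities and cross-sections\<close>

locale neutron_walk =
  fixes N :: neutron_system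
  assumes standing: "standing_assumptions N"
begin

abbreviation "D \<equiv> domain N"
abbreviation "V \<equiv> velocities N"

lemma domain_facts: "D \<noteq> {}" "open D" "bounded D"
  and v_min: "0 < v_min N" "v_min N < v_max N"
  and cross_section_measurable:
    "(\<lambda>(r, v). sigma_s N r v) \<in> borel_measurable (restrict_space borel (D \<times> V))"
    "(\<lambda>(r, v). sigma_f N r v) \<in> borel_measurable (restrict_space borel (D \<times> V))"
    "(\<lambda>(r, v, v'). pi_s N r v v') \<in> borel_measurable (restrict_space borel (D \<times> V \<times> V))"
    "(\<lambda>(r, v, v'). pi_f N r v v') \<in> borel_measurable (restrict_space borel (D \<times> V \<times> V))"
  and cross_section_nonneg:
    "\<And>r v. r \<in> D \<Longrightarrow> v \<in> V \<Longrightarrow> 0 \<le> sigma_s N r v"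
    "\<And>r v. r \<in> D \<Longrightarrow> v \<in> V \<Longrightarrow> 0 \<le> sigma_f N r v"
    "\<And>r v v'. r \<in> D \<Longrightarrow> v \<in> V \<Longrightarrow> v' \<in> V \<Longrightarrow> 0 \<le> pi_s N r v v'"
    "\<And>r v v'. r \<in> D \<Longrightarrow> v \<in> V \<Longrightarrow> v' \<in> V \<Longrightarrow> 0 \<le> pi_f N r v v'"
  and cross_section_bounded: "\<exists>c. (\<forall>r\<in>D. \<forall>v\<in>V. sigma_s N r v \<le> c \<and> sigma_f N r v \<le> c) \<and>
           (\<forall>r\<in>D. \<forall>v\<in>V. \<forall>v'\<in>V. pi_s N r v v' \<le> c \<and> pi_f N r v v' \<le> c)"
  and rate_INF_pos: "0 < (INF (r, v, v')\<in>D \<times> V \<times> V.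
    sigma_s N r v * pi_s N r v v' + sigma_f N r v * pi_f N r v v')"
  and fission_yield_le: "\<And>r v. r \<in> D \<Longrightarrow> v \<in> V \<Longrightarrow> (LINT v':V|lborel. pi_f N r v v') \<le> n_max N"
  and n_max: "1 < n_max N"
  using standing unfolding standing_assumptions_def Let_def by blast+

lemma domain_borel [measurable]: "D \<in> sets borel"
  using domain_facts by simp

lemma compact_V: "compact V"
proof -
  have "V = cball 0 (v_max N) \<inter> - ball 0 (v_min N)"
    by (auto simp: velocities_def)
  then show ?thesis by (auto intro!: compact_Int_closed)
qed

lemma V_borel [measurable]: "V \<in> sets borel"
  using compact_V by (simp add: compact_imp_closed)

lemma V_finite: "emeasure lborel V < \<infinity>" "emeasure lborel V \<noteq> \<infinity>"
  using emeasure_compact_finite[OF compact_V] by auto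

lemma norm_V: "v \<in> V \<Longrightarrow> v_min N \<le> norm v"
  by (simp add: velocities_def)

text \<open>\<open>V\<close> contains an open shell, non-empty because a vector of norm midway
  between \<open>v_min N\<close> and \<open>v_max N\<close> lies in it, and a non-empty open set is
  not Lebesgue null. Uniform scattering outside the domain divides by this volume.\<close>

lemma V_measure_pos: "0 < measure lborel V"
proof -
  define U :: "vec3 set" where "U = ball 0 (v_max N) \<inter> - cball 0 (v_min N)"
  have "open U" unfolding U_def by (intro open_Int) auto
  moreover have "((v_min N + v_max N) / 2) *\<^sub>R axis 1 1 \<in> U"
    using v_min by (auto simp: U_def norm_axis_1)
  ultimately have "U \<notin> null_sets lebesgue"
    using open_not_negligible[of U] by (auto simp: negligible_iff_null_sets)
  then have "\<not> emeasure lborel U = 0" using \<open>open U\<close> by (auto simp: null_sets_def)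
  moreover have "emeasure lborel U \<le> emeasure lborel V"
    by (intro emeasure_mono) (auto simp: U_def velocities_def)
  ultimately have "0 < emeasure lborel V" using zero_less_iff_neq_zero by fastforce
  then show ?thesis using V_finite by (simp add: measure_def enn2real_positive_iff)
qed

lemma V_nonempty: "V \<noteq> {}"
  using V_measure_pos by auto

section \<open>Borel versions of the rates\<close>

lemma cross_section_extension:
  "(\<lambda>(r, v). indicator (D \<times> V) (r, v) * sigma_s N r v) \<in> borel_measurable borel"
  "(\<lambda>(r, v). indicator (D \<times> V) (r, v) * sigma_f N r v) \<in> borel_measurable borel"
  "(\<lambda>(r, v, v'). indicator (D \<times> V \<times> V) (r, v, v') * pi_s N r v v') \<in> borel_measurable borel"
  "(\<lambda>(r, v, v'). indicator (D \<times> V \<times> V) (r, v, v') * pi_f N r v v') \<in> borel_measurable borel"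
  using cross_section_measurable
  by (simp_all add: borel_measurable_restrict_space_iff borel_Times case_prod_beta')

text \<open>\<open>jump_rate\<close> is \<open>\<alpha> \<pi>\<close> and \<open>total_rate\<close> is \<open>\<alpha>\<close>, both extended by 0 to velocities outside \<open>V\<close> so that
  they are Borel measurable on the whole space.\<close>

definition jump_rate :: "vec3 \<Rightarrow> vec3 \<Rightarrow> vec3 \<Rightarrow> real" where
  "jump_rate r v v' = indicator (V \<times> V) (v, v') *
     (if r \<in> D then sigma_s N r v * pi_s N r v v' + sigma_f N r v * pi_f N r v v'
      else 1 / measure lborel V)"

definition total_rate :: "vec3 \<Rightarrow> vec3 \<Rightarrow> real" where
  "total_rate r v = (\<integral>v'. jump_rate r v v' \<partial>lborel)"

text \<open>Wherever the outer indicator is nonzero and the position is in \<open>D\<close>, the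
  zero extensions agree with the cross-sections, so they may be substituted without changing the
  function.\<close>

lemma jump_rate_measurable [measurable]:
  "(\<lambda>(r, v, v'). jump_rate r v v') \<in> borel_measurable borel"
proof -
  let ?s = "\<lambda>(r, v). indicator (D \<times> V) (r, v) * sigma_s N r v :: real"
  let ?f = "\<lambda>(r, v). indicator (D \<times> V) (r, v) * sigma_f N r v :: real"
  let ?ps = "\<lambda>(r, v, v'). indicator (D \<times> V \<times> V) (r, v, v') * pi_s N r v v' :: real"
  let ?pf = "\<lambda>(r, v, v'). indicator (D \<times> V \<times> V) (r, v, v') * pi_f N r v v' :: real"
  have "(\<lambda>x. indicator (V \<times> V) (snd x) * (if fst x \<in> D then ?s (fst x, fst (snd x)) * ?ps x
       + ?f (fst x, fst (snd x)) * ?pf x else 1 / measure lborel V))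
     \<in> borel_measurable (borel :: (vec3 \<times> vec3 \<times> vec3) measure)"
    unfolding borel_prod[symmetric]
    using cross_section_extension[unfolded borel_prod[symmetric]] by measurable
  also have "(\<lambda>x. indicator (V \<times> V) (snd x) * (if fst x \<in> D then ?s (fst x, fst (snd x)) * ?ps x
       + ?f (fst x, fst (snd x)) * ?pf x else 1 / measure lborel V)) = (\<lambda>(r, v, v'). jump_rate r v v')"
    by (auto simp: jump_rate_def fun_eq_iff indicator_def)
  finally show ?thesis .
qed

lemma jump_rate_measurable2 [measurable (raw)]:
  assumes [measurable]: "f \<in> M \<rightarrow>\<^sub>M borel" "g \<in> M \<rightarrow>\<^sub>M borel" "h \<in> M \<rightarrow>\<^sub>M borel"
  shows "(\<lambda>x. jump_rate (f x) (g x) (h x)) \<in> borel_measurable M"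
proof -
  have "(\<lambda>x. (f x, g x, h x)) \<in> M \<rightarrow>\<^sub>M borel" unfolding borel_prod[symmetric] by measurable
  from measurable_compose[OF this jump_rate_measurable] show ?thesis by simp
qed

lemma total_rate_measurable [measurable (raw)]:
  assumes [measurable]: "f \<in> M \<rightarrow>\<^sub>M borel" "g \<in> M \<rightarrow>\<^sub>M borel"
  shows "(\<lambda>x. total_rate (f x) (g x)) \<in> borel_measurable M"
  unfolding total_rate_def by measurable

lemma jump_rate_nonneg: "0 \<le> jump_rate r v v'"
  using cross_section_nonneg V_measure_pos by (auto simp: jump_rate_def indicator_def)

text \<open>The indicator on the right makes the bound integrable in \<open>v'\<close>, since
  \<open>V\<close> has finite volume.\<close>

lemma jump_rate_bounded: "\<exists>B. \<forall>r v v'. jump_rate r v v' \<le> B * indicator V v'"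
proof -
  obtain c where c: "\<And>r v. r \<in> D \<Longrightarrow> v \<in> V \<Longrightarrow> sigma_s N r v \<le> c \<and> sigma_f N r v \<le> c"
      "\<And>r v v'. r \<in> D \<Longrightarrow> v \<in> V \<Longrightarrow> v' \<in> V \<Longrightarrow> pi_s N r v v' \<le> c \<and> pi_f N r v v' \<le> c"
    using cross_section_bounded by blast
  have "0 \<le> c" using c(1) cross_section_nonneg(1) domain_facts(1) V_nonempty by fastforce
  have le: "sigma_s N r v * pi_s N r v v' + sigma_f N r v * pi_f N r v v' \<le> c * c + c * c"
    if "r \<in> D" "v \<in> V" "v' \<in> V" for r v v'
    using that c cross_section_nonneg \<open>0 \<le> c\<close> by (intro add_mono mult_mono) auto
  have "jump_rate r v v' \<le> (c * c + c * c + 1 / measure lborel V) * indicator V v'" for r v v'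
  proof -
    have "0 \<le> c * c" "0 \<le> 1 / measure lborel V" using V_measure_pos by auto
    then have "r \<in> D \<Longrightarrow> v \<in> V \<Longrightarrow> v' \<in> V \<Longrightarrow>
        sigma_s N r v * pi_s N r v v' + sigma_f N r v * pi_f N r v v' \<le> c * c + c * c + 1 / measure lborel V"
      using le[of r v v'] by linarith
    then show ?thesis using \<open>0 \<le> c * c\<close> \<open>0 \<le> 1 / measure lborel V\<close>
      by (auto simp: jump_rate_def split: split_indicator)
  qed
  then show ?thesis by blast
qed

lemma jump_rate_integrable: "integrable lborel (jump_rate r v)"
proof -
  obtain B where B: "\<And>v'. jump_rate r v v' \<le> B * indicator V v'" using jump_rate_bounded by blast
  show ?thesis
  proof (rule integrableI_bounded_set[where A=V and B=B])
    show "AE x\<in>V in lborel. norm (jump_rate r v x) \<le> B"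
    proof (intro AE_I2 impI)
      fix v' show "norm (jump_rate r v v') \<le> B" if "v' \<in> V"
        using B[of v'] jump_rate_nonneg[of r v v'] that by simp
    qed
  qed (use V_finite in \<open>auto simp: jump_rate_def\<close>)
qed

lemma total_rate_nonneg: "0 \<le> total_rate r v"
  unfolding total_rate_def by (intro integral_nonneg_AE AE_I2 jump_rate_nonneg)

lemma total_rate_bounded: "\<exists>B. \<forall>r v. total_rate r v \<le> B"
proof -
  obtain B where B: "\<And>r v v'. jump_rate r v v' \<le> B * indicator V v'" using jump_rate_bounded by blast
  have "total_rate r v \<le> (\<integral>v'. B * indicator V v' \<partial>lborel)" for r v
    unfolding total_rate_def using V_finite by (intro integral_mono jump_rate_integrable B) auto
  then show ?thesis by blast
qed

lemma total_rate_outside: "r \<notin> D \<Longrightarrow> v \<in> V \<Longrightarrow> total_rate r v = 1"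
  using V_measure_pos V_finite by (simp add: total_rate_def jump_rate_def indicator_times)

text \<open>Inside \<open>D\<close> the positive infimum of the scattering rates, times the volume
  of \<open>V\<close>, is a lower bound; outside, the rate is 1. Positivity legitimises the division
  by \<alpha> in \<open>pi_walk\<close>.\<close>

lemma total_rate_pos:
  assumes "v \<in> V" shows "0 < total_rate r v"
proof (cases "r \<in> D")
  case True
  define c where "c = (INF (r, v, v')\<in>D \<times> V \<times> V. sigma_s N r v * pi_s N r v v' + sigma_f N r v * pi_f N r v v')"
  have "c \<le> jump_rate r v v'" if "v' \<in> V" for v'
  proof -
    have "c \<le> (\<lambda>(r, v, v'). sigma_s N r v * pi_s N r v v' + sigma_f N r v * pi_f N r v v') (r, v, v')"
      unfolding c_def
      \<comment> \<open>A real infimum bounds its set from below only if the set is bounded below;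
        nonnegativity of the cross-sections supplies the bound 0.\<close>
      by (rule cINF_lower) (use that assms True cross_section_nonneg in \<open>auto intro!: bdd_belowI[where m=0]\<close>)
    then show ?thesis using True assms that by (simp add: jump_rate_def)
  qed
  then have le: "c * indicator V v' \<le> jump_rate r v v'" for v'
    by (cases "v' \<in> V") (simp_all add: jump_rate_nonneg)
  have "integrable lborel (\<lambda>v'. c * indicator V v')"
    using V_finite by (intro integrable_mult_right integrable_real_indicator) auto
  then have "(\<integral>v'. c * indicator V v' \<partial>lborel) \<le> total_rate r v"
    unfolding total_rate_def by (intro integral_mono jump_rate_integrable le)
  then have "c * measure lborel V \<le> total_rate r v" by simp
  moreover have "0 < c * measure lborel V"
    using rate_INF_pos V_measure_pos by (simp add: c_def)
  ultimately show ?thesis by (rule less_le_trans[rotated])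
qed (use assms total_rate_outside in simp)

lemma alpha_eq_total_rate: "v \<in> V \<Longrightarrow> alpha N r v = total_rate r v"
  by (cases "r \<in> D")
     (simp_all add: alpha_def total_rate_outside, simp add: total_rate_def jump_rate_def
       set_lebesgue_integral_def indicator_times)

text \<open>The quotient in \<open>pi_walk\<close> cancels because \<alpha> is positive. The
  transition density thereby depends on \<open>jump_rate\<close> and its integral only, both Borel
  on the whole space.\<close>

lemma alpha_times_pi_walk:
  "v \<in> V \<Longrightarrow> v' \<in> V \<Longrightarrow> alpha N r v * pi_walk N r v v' = jump_rate r v v'"
  using total_rate_pos[of v r]
  by (auto simp: alpha_eq_total_rate pi_walk_def total_rate_outside) (auto simp: jump_rate_def)

section \<open>One transition of the skeleton\<close>

definition event_density :: "event \<Rightarrow> real \<times> vec3 \<Rightarrow> ennreal" where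
  "event_density = (\<lambda>(a, r, v) (u, v'). ennreal (indicator {0..} u *
     exp (- (LINT w:{0..u}|lborel. total_rate (r + w *\<^sub>R v) v)) * jump_rate (r + u *\<^sub>R v) v v'))"

abbreviation "L \<equiv> lborel \<Otimes>\<^sub>M restrict_space lborel V :: (real \<times> vec3) measure"

lemma space_event_space: "space (event_space N) = UNIV \<times> UNIV \<times> V"
  by (simp add: event_space_def space_pair_measure space_restrict_space)

lemma space_L: "space L = UNIV \<times> V"
  by (simp add: space_pair_measure space_restrict_space)

lemma sigma_finite_restrict_V: "sigma_finite_measure (restrict_space lborel V)"
  by (rule sigma_finite_measure_restrict_space) (auto intro: sigma_finite_lborel)

lemma sigma_finite_L: "sigma_finite_measure L"
  by (intro sigma_finite_pair_measure sigma_finite_restrict_V sigma_finite_lborel)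

lemma measurable_event_coordinates [measurable]:
  "(\<lambda>x. fst x) \<in> event_space N \<rightarrow>\<^sub>M borel"
  "(\<lambda>x. fst (snd x)) \<in> event_space N \<rightarrow>\<^sub>M borel"
  "(\<lambda>x. snd (snd x)) \<in> event_space N \<rightarrow>\<^sub>M borel"
  "(\<lambda>y. fst y) \<in> L \<rightarrow>\<^sub>M borel"
  "(\<lambda>y. snd y) \<in> L \<rightarrow>\<^sub>M borel"
  "(\<lambda>y. snd y) \<in> L \<rightarrow>\<^sub>M restrict_space borel V"
proof -
  show "(\<lambda>x. snd (snd x)) \<in> event_space N \<rightarrow>\<^sub>M borel" unfolding event_space_def
    by (rule measurable_compose[OF _ measurable_id_restrict_space_borel]) measurable
  \<comment> \<open>Restricting \<open>lborel\<close> and restricting \<open>borel\<close> to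
    \<open>V\<close> give different measures but the same measurable sets.\<close>
  have [measurable_cong]: "sets (restrict_space lborel V) = sets (restrict_space borel V)"
    by (simp add: sets_restrict_space)
  show "(\<lambda>y. snd y) \<in> L \<rightarrow>\<^sub>M restrict_space borel V" by measurable
  then show "(\<lambda>y. snd y) \<in> L \<rightarrow>\<^sub>M borel"
    by (rule measurable_compose[OF _ measurable_id_restrict_space_borel])
qed (simp_all add: event_space_def)

lemma event_density_measurable:
  "case_prod event_density \<in> borel_measurable (event_space N \<Otimes>\<^sub>M L)"
proof -
  \<comment> \<open>The integral over \<open>{0..u}\<close> has a moving endpoint. Written over the
    whole line with a measurable cut-off, it becomes a parameter integral, whose measurability
    follows from Fubini.\<close>
  have "(\<lambda>((a, r, v), (u, v')). ennreal (indicator {0..} u *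
     exp (- (\<integral>w. (if 0 \<le> w \<and> w \<le> u then 1 else 0) * total_rate (r + w *\<^sub>R v) v \<partial>lborel)) *
       jump_rate (r + u *\<^sub>R v) v v'))
    \<in> borel_measurable (event_space N \<Otimes>\<^sub>M L)"
    unfolding case_prod_beta by measurable
  also have "(\<lambda>((a, r, v), (u, v')). ennreal (indicator {0..} u *
     exp (- (\<integral>w. (if 0 \<le> w \<and> w \<le> u then 1 else 0) * total_rate (r + w *\<^sub>R v) v \<partial>lborel)) *
       jump_rate (r + u *\<^sub>R v) v v')) = case_prod event_density"
    by (auto simp: fun_eq_iff event_density_def set_lebesgue_integral_def indicator_def
        intro!: arg_cong[where f=ennreal] Bochner_Integration.integral_cong)
  finally show ?thesis .
qed

lemma event_density_measurable_section:
  assumes "x \<in> space (event_space N)"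
  shows "event_density x \<in> borel_measurable L"
  using measurable_compose[OF measurable_Pair1'[OF assms] event_density_measurable] by simp

lemma event_map_measurable:
  "(\<lambda>(x, u, v'). (fst x + u, fst (snd x) + u *\<^sub>R snd (snd x), v')) \<in> event_space N \<Otimes>\<^sub>M L \<rightarrow>\<^sub>M event_space N"
proof -
  have "(\<lambda>x. (fst (fst x) + fst (snd x), fst (snd (fst x)) + fst (snd x) *\<^sub>R snd (snd (fst x)), snd (snd x)))
    \<in> event_space N \<Otimes>\<^sub>M L \<rightarrow>\<^sub>M borel \<Otimes>\<^sub>M borel \<Otimes>\<^sub>M restrict_space borel V"
    by measurable
  then show ?thesis by (simp only: case_prod_beta' event_space_def[symmetric])
qed

text \<open>A density matters only on the space of \<open>L\<close>, where all velocities lie in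
  \<open>V\<close> and \<open>alpha\<close> and \<open>pi_walk\<close> can be exchanged for
  \<open>total_rate\<close> and \<open>jump_rate\<close>. In this form the dependence on
  \<open>x\<close> is jointly measurable.\<close>

lemma next_event_eq:
  assumes "x \<in> space (event_space N)"
  shows "next_event N x = distr (density L (event_density x)) (event_space N)
    (\<lambda>(u, v'). (fst x + u, fst (snd x) + u *\<^sub>R snd (snd x), v'))"
proof -
  obtain a r v where x: "x = (a, r, v)" by (cases x)
  then have v: "v \<in> V" using assms by (simp add: space_event_space)
  have *: "(\<lambda>y. event_density x y) \<in> borel_measurable L"
    using assms by (rule event_density_measurable_section)
  have "density L (event_density x) = density L (\<lambda>(u, v'). ennreal (indicator {0..} u *
            exp (- (LINT w:{0..u}|lborel. alpha N (r + w *\<^sub>R v) v)) *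
            alpha N (r + u *\<^sub>R v) v * pi_walk N (r + u *\<^sub>R v) v v'))" (is "_ = density L ?g")
  proof -
    have eq: "event_density x y = ?g y" if "y \<in> space L" for y
      using that v by (auto simp: event_density_def x space_L alpha_times_pi_walk mult.assoc)
        (simp add: alpha_eq_total_rate)
    moreover have "?g \<in> borel_measurable L" using * eq by (simp cong: measurable_cong)
    ultimately show ?thesis using * by (intro density_cong AE_I2)
  qed
  then show ?thesis by (simp add: next_event_def x)
qed

text \<open>Integrating out the new velocity turns \<open>jump_rate\<close> into
  \<open>total_rate\<close>; what remains is the law of the waiting time, of mass 1 by
  \<open>survival_integral\<close>.\<close>

lemma nn_integral_event_density:
  assumes "x \<in> space (event_space N)"
  shows "(\<integral>\<^sup>+y. event_density x y \<partial>L) = 1"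
proof -
  obtain a r v where x: "x = (a, r, v)" by (cases x)
  then have v: "v \<in> V" using assms by (simp add: space_event_space)
  interpret V: sigma_finite_measure "restrict_space lborel V" by (rule sigma_finite_restrict_V)
  have *: "(\<lambda>y. event_density x y) \<in> borel_measurable L"
    using assms by (rule event_density_measurable_section)
  let ?a = "\<lambda>u. total_rate (r + u *\<^sub>R v) v"
  let ?h = "\<lambda>u. indicator {0..} u * exp (- (LINT w:{0..u}|lborel. ?a w))"
  have "(\<integral>\<^sup>+y. event_density x y \<partial>L) = (\<integral>\<^sup>+u. \<integral>\<^sup>+v'. event_density x (u, v') \<partial>restrict_space lborel V \<partial>lborel)"
    using V.nn_integral_fst[OF *] by simp
  also have "\<dots> = (\<integral>\<^sup>+u. ennreal (?h u * ?a u) \<partial>lborel)"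
  proof (rule nn_integral_cong)
    fix u
    have "(\<integral>\<^sup>+v'. event_density x (u, v') \<partial>restrict_space lborel V)
      = (\<integral>\<^sup>+v'. ennreal (?h u) * ennreal (jump_rate (r + u *\<^sub>R v) v v') \<partial>lborel)"
      by (subst nn_integral_restrict_space)
        (auto simp: x event_density_def ennreal_mult' jump_rate_def indicator_def intro!: nn_integral_cong)
    also have "\<dots> = ennreal (?h u * ?a u)"
      unfolding total_rate_def
      by (subst nn_integral_cmult) (auto simp: ennreal_mult' nn_integral_eq_integral jump_rate_integrable jump_rate_nonneg)
    finally show "(\<integral>\<^sup>+v'. event_density x (u, v') \<partial>restrict_space lborel V) = ennreal (?h u * ?a u)" .
  qed
  also have "\<dots> = 1"
  proof -
    obtain R where R: "\<And>y. y \<in> D \<Longrightarrow> norm y \<le> R" using domain_facts(3) by (auto simp: bounded_iff)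
    obtain B where B: "\<And>r v. total_rate r v \<le> B" using total_rate_bounded by blast
    \<comment> \<open>Speeds are at least \<open>v_min N\<close>, so after this time the particle
      has moved by at least \<open>\<bar>R\<bar> + norm r + 1\<close>. It has left the ball of
      radius \<open>R\<close> containing \<open>D\<close>, and its rate is 1.\<close>
    show ?thesis
    proof (rule survival_integral[where c=B and T="(\<bar>R\<bar> + norm r + 1) / v_min N"])
      fix u assume u: "(\<bar>R\<bar> + norm r + 1) / v_min N \<le> u"
      then have "\<bar>R\<bar> + norm r + 1 \<le> u * v_min N" using v_min by (simp add: field_simps)
      moreover have "0 \<le> u" using u v_min by (intro order.trans[OF _ u]) simp
      then have "u * v_min N \<le> norm (u *\<^sub>R v)" using norm_V[OF v] by (simp add: mult_left_mono)
      moreover have "norm (u *\<^sub>R v) \<le> norm (r + u *\<^sub>R v) + norm r"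
        using norm_triangle_ineq4[of "r + u *\<^sub>R v" r] by simp
      ultimately have "R < norm (r + u *\<^sub>R v)" by linarith
      then show "?a u = 1" using R v by (intro total_rate_outside) force+
    qed (use B total_rate_nonneg in auto)
  qed
  finally show ?thesis .
qed

lemma prob_space_next_event:
  assumes "x \<in> space (event_space N)"
  shows "prob_space (next_event N x)"
  unfolding next_event_eq[OF assms]
proof (rule prob_space.prob_space_distr)
  have "(\<lambda>y. event_density x y) \<in> borel_measurable L"
    using assms by (rule event_density_measurable_section)
  then show "prob_space (density L (event_density x))"
    using sets.top[of L]
    by (intro prob_spaceI) (subst emeasure_density,
      auto simp: nn_integral_event_density[OF assms, symmetric] intro!: nn_integral_cong)
  show "(\<lambda>(u, v'). (fst x + u, fst (snd x) + u *\<^sub>R snd (snd x), v'))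
      \<in> density L (event_density x) \<rightarrow>\<^sub>M event_space N"
    using measurable_compose[OF measurable_Pair1'[OF assms] event_map_measurable] by (simp add: case_prod_beta)
qed

text \<open>Pulled back to \<open>L\<close>, the mass of a set is the integral of a jointly
  measurable function against a fixed sigma-finite measure, hence measurable in \<open>x\<close> by
  Tonelli.\<close>

lemma next_event_measurable [measurable]:
  "next_event N \<in> event_space N \<rightarrow>\<^sub>M subprob_algebra (event_space N)"
proof (rule measurable_subprob_algebra)
  show "subprob_space (next_event N x)" if "x \<in> space (event_space N)" for x
    using prob_space_next_event[OF that] by (rule prob_space_imp_subprob_space)
  show "sets (next_event N x) = sets (event_space N)" if "x \<in> space (event_space N)" for x
    using that by (simp add: next_event_eq)
  fix A assume A [measurable]: "A \<in> sets (event_space N)"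
  interpret L: sigma_finite_measure L by (rule sigma_finite_L)
  let ?h = "\<lambda>x (u, v'). (fst x + u, fst (snd x) + u *\<^sub>R snd (snd x), v')"
  have h [measurable]: "case_prod ?h \<in> event_space N \<Otimes>\<^sub>M L \<rightarrow>\<^sub>M event_space N"
    using event_map_measurable by simp
  note [measurable] = event_density_measurable
  have "(\<lambda>x. \<integral>\<^sup>+y. event_density x y * indicator A (?h x y) \<partial>L) \<in> borel_measurable (event_space N)"
    by measurable
  moreover have "emeasure (next_event N x) A = (\<integral>\<^sup>+y. event_density x y * indicator A (?h x y) \<partial>L)"
    if x: "x \<in> space (event_space N)" for x
  proof -
    have hx [measurable]: "?h x \<in> L \<rightarrow>\<^sub>M event_space N"
      using measurable_compose[OF measurable_Pair1'[OF x] h] by simp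
    have [measurable]: "event_density x \<in> borel_measurable L"
      using x by (rule event_density_measurable_section)
    show ?thesis unfolding next_event_eq[OF x]
      by (subst emeasure_distr, simp, simp, subst emeasure_density)
         (use measurable_sets[OF hx A] in \<open>auto intro!: nn_integral_cong split: split_indicator\<close>)
  qed
  ultimately show "(\<lambda>x. emeasure (next_event N x) A) \<in> borel_measurable (event_space N)"
    by (simp cong: measurable_cong)
qed

section \<open>Existence of the law of the skeleton\<close>

lemma Ionescu_Tulcea_event_kernel:
  assumes "v \<in> V"
  shows "Ionescu_Tulcea (event_kernel N r v) (\<lambda>_. event_space N)"
  unfolding Ionescu_Tulcea_def
proof (intro conjI allI impI)
  \<comment> \<open>\<open>return\<close> has mass 1 only at a point of its space; this is where the
    starting velocity must belong to \<open>V\<close>.\<close>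
  have start: "(0, r, v) \<in> space (event_space N)" using assms by (simp add: space_event_space)
  show "event_kernel N r v i \<in> PiM {0..<i} (\<lambda>_. event_space N) \<rightarrow>\<^sub>M subprob_algebra (event_space N)" for i
    using start
    by (cases i) (auto simp: event_kernel_def[abs_def] intro!: prob_space.M_in_subprob
      measurable_compose[OF _ next_event_measurable] measurable_compose[OF _ return_measurable])
  show "prob_space (event_kernel N r v i \<omega>)"
    if "\<omega> \<in> space (PiM {0..<i} (\<lambda>_. event_space N))" for i \<omega>
    using start that
    by (cases i) (auto simp: event_kernel_def space_PiM PiE_iff
      intro: prob_space_return prob_space_next_event)
qed

lemma prob_space_walk_law:
  assumes "v \<in> V" shows "prob_space (walk_law N r v)"
  unfolding walk_law_def
  by (intro prob_space.prob_space_completion Ionescu_Tulcea_prob_space_lim Ionescu_Tulcea_event_kernel assms)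

text \<open>Completion does not change the underlying space. Bounds on paths can therefore be proved
  for every skeleton with velocities in \<open>V\<close>, without exceptional null sets.\<close>

lemma space_walk_law:
  assumes "v \<in> V" shows "space (walk_law N r v) = space (PiM UNIV (\<lambda>_::nat. event_space N))"
proof -
  interpret Ionescu_Tulcea "event_kernel N r v" "\<lambda>_. event_space N"
    using assms by (rule Ionescu_Tulcea_event_kernel)
  show ?thesis by (simp add: walk_law_def)
qed

section \<open>Weights of paths\<close>

lemma beta_measurable:
  "(\<lambda>(r, v). indicator (D \<times> V) (r, v) * beta N r v) \<in> borel_measurable borel"
proof -
  let ?f = "\<lambda>(r, v). indicator (D \<times> V) (r, v) * sigma_f N r v :: real"
  let ?pf = "\<lambda>(r, v, v'). indicator (D \<times> V \<times> V) (r, v, v') * pi_f N r v v' :: real"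
  have "(\<lambda>x. ?f x * ((\<integral>v'. ?pf (fst x, snd x, v') \<partial>lborel) - 1))
     \<in> borel_measurable (borel :: (vec3 \<times> vec3) measure)"
    unfolding borel_prod[symmetric]
    using cross_section_extension[unfolded borel_prod[symmetric]] by measurable
  also have "(\<lambda>x. ?f x * ((\<integral>v'. ?pf (fst x, snd x, v') \<partial>lborel) - 1)) =
      (\<lambda>(r, v). indicator (D \<times> V) (r, v) * beta N r v)"
    by (auto simp: fun_eq_iff indicator_def beta_def set_lebesgue_integral_def
        intro!: Bochner_Integration.integral_cong)
  finally show ?thesis .
qed

text \<open>The mean yield lies in \<open>[0, n_max N]\<close> and \<open>n_max N\<close> exceeds 1,
  so subtracting 1 leaves an absolute value of at most \<open>n_max N\<close>. The two-sided bound
  makes both \<open>beta_sup N\<close> and \<open>beta_inf N\<close> genuine extrema and path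
  integrals of \<open>beta N\<close> finite.\<close>

lemma beta_bounded: "\<exists>B. \<forall>r\<in>D. \<forall>v\<in>V. \<bar>beta N r v\<bar> \<le> B"
proof -
  obtain c where c: "\<And>r v. r \<in> D \<Longrightarrow> v \<in> V \<Longrightarrow> sigma_f N r v \<le> c"
    using cross_section_bounded by blast
  have "\<bar>beta N r v\<bar> \<le> c * n_max N" if rv: "r \<in> D" "v \<in> V" for r v
  proof -
    have "0 \<le> (LINT v':V|lborel. pi_f N r v v')"
      unfolding set_lebesgue_integral_def
      by (intro integral_nonneg_AE AE_I2) (use cross_section_nonneg(4) rv in \<open>auto simp: indicator_def\<close>)
    then have "\<bar>(LINT v':V|lborel. pi_f N r v v') - 1\<bar> \<le> n_max N"
      using fission_yield_le[OF rv] n_max by linarith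
    then show ?thesis using c[OF rv] cross_section_nonneg(2)[OF rv]
      unfolding beta_def abs_mult by (intro mult_mono) auto
  qed
  then show ?thesis by blast
qed

lemma beta_le_beta_sup: "r \<in> D \<Longrightarrow> v \<in> V \<Longrightarrow> beta N r v \<le> beta_sup N"
  and beta_inf_le_beta: "r \<in> D \<Longrightarrow> v \<in> V \<Longrightarrow> beta_inf N \<le> beta N r v"
proof -
  assume rv: "r \<in> D" "v \<in> V"
  obtain B where B: "\<And>r v. r \<in> D \<Longrightarrow> v \<in> V \<Longrightarrow> \<bar>beta N r v\<bar> \<le> B"
    using beta_bounded by blast
  have "bdd_above ((\<lambda>(r, v). beta N r v) ` (D \<times> V))" "bdd_below ((\<lambda>(r, v). beta N r v) ` (D \<times> V))"
    using B by (auto intro!: bdd_aboveI[where M=B] bdd_belowI[where m="-B"] simp: abs_le_iff minus_le_iff)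
  then show "beta N r v \<le> beta_sup N" "beta_inf N \<le> beta N r v"
    using rv unfolding beta_sup_def beta_inf_def
    by (auto intro!: cSUP_upper2[of _ _ "(r, v)"] cINF_lower2[of _ _ "(r, v)"])
qed

text \<open>The index of the last event is a Borel function of time with countably many values, and
  for each fixed index the path is affine in time. Degenerate skeletons are included.\<close>

lemma path_measurable:
  "(\<lambda>t. walk_pos \<omega> t) \<in> borel \<rightarrow>\<^sub>M borel" "(\<lambda>t. walk_vel \<omega> t) \<in> borel \<rightarrow>\<^sub>M borel"
proof -
  have n [measurable]: "(\<lambda>t::real. LEAST n. t < fst (\<omega> (Suc n))) \<in> borel \<rightarrow>\<^sub>M count_space UNIV"
    by measurable
  show "(\<lambda>t. walk_vel \<omega> t) \<in> borel \<rightarrow>\<^sub>M borel"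
    unfolding walk_vel_def last_event_def case_prod_beta
    by (rule measurable_compose_countable[OF _ n]) measurable
  show "(\<lambda>t. walk_pos \<omega> t) \<in> borel \<rightarrow>\<^sub>M borel"
    unfolding walk_pos_def last_event_def case_prod_beta
    by (rule measurable_compose_countable[OF _ n]) measurable
qed

text \<open>Whatever index \<open>LEAST\<close> returns, \<open>last_event\<close> is one of the
  coordinates of the skeleton.\<close>

lemma walk_vel_in_V:
  assumes "\<omega> \<in> space (PiM UNIV (\<lambda>_::nat. event_space N))"
  shows "walk_vel \<omega> t \<in> V"
proof -
  have "last_event \<omega> t \<in> space (event_space N)"
    using assms by (auto simp: last_event_def space_PiM)
  then show ?thesis by (auto simp: walk_vel_def space_event_space split: prod.splits)
qed

lemma walk_pos_in_D:
  assumes "ereal t < exit_time N \<omega>" "0 < s" "s \<le> t"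
  shows "walk_pos \<omega> s \<in> D"
proof (rule ccontr)
  assume "walk_pos \<omega> s \<notin> D"
  then have "exit_time N \<omega> \<le> ereal s"
    unfolding exit_time_def using assms by (auto intro: INF_lower)
  then show False using assms by (metis ereal_less_eq(3) not_less order_trans)
qed

lemma integral_beta_path_le:
  assumes \<omega>: "\<omega> \<in> space (PiM UNIV (\<lambda>_::nat. event_space N))"
    and t: "0 \<le> t" "ereal t < exit_time N \<omega>"
  shows "(LINT s:{0..t}|lborel. beta N (walk_pos \<omega> s) (walk_vel \<omega> s)) \<le> beta_sup N * t"
proof -
  let ?b = "\<lambda>s. beta N (walk_pos \<omega> s) (walk_vel \<omega> s)"
  let ?e = "\<lambda>s. indicator (D \<times> V) (walk_pos \<omega> s, walk_vel \<omega> s) * ?b s"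
  have inside: "walk_pos \<omega> s \<in> D" "walk_vel \<omega> s \<in> V" if "0 < s" "s \<le> t" for s
    using that t walk_pos_in_D walk_vel_in_V[OF \<omega>] by auto
  have "(\<lambda>t. (walk_pos \<omega> t, walk_vel \<omega> t)) \<in> borel \<rightarrow>\<^sub>M borel"
    unfolding borel_prod[symmetric] using path_measurable by measurable
  from measurable_compose[OF this beta_measurable]
  have [measurable]: "?e \<in> borel_measurable borel" by simp
  \<comment> \<open>Splitting off time 0 makes this function equal to the integrand everywhere,
    including the one time at which the position may lie outside \<open>D\<close>.\<close>
  have "(\<lambda>s. indicator {0<..t} s * ?e s + indicator {0} s * ?b 0) \<in> borel_measurable borel"
    by measurable
  also have "(\<lambda>s. indicator {0<..t} s * ?e s + indicator {0} s * ?b 0) = (\<lambda>s. indicator {0..t} s * ?b s)"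
    using t inside by (auto simp: fun_eq_iff indicator_def)
  finally have [measurable]: "(\<lambda>s. indicator {0..t} s * ?b s) \<in> borel_measurable borel" .
  obtain B where B: "\<And>r v. r \<in> D \<Longrightarrow> v \<in> V \<Longrightarrow> \<bar>beta N r v\<bar> \<le> B"
    using beta_bounded by blast
  \<comment> \<open>The exit time ignores the position at time 0, which need not be in \<open>D\<close>.\<close>
  have nz: "AE s in lborel. s \<noteq> (0::real)" by (rule AE_lborel_singleton)
  \<comment> \<open>Integrability matters for the sign: a non-integrable function has integral 0 by
    convention, which would exceed the bound when \<open>beta_sup N\<close> is negative and
    \<open>t\<close> positive.\<close>
  have "integrable lborel (\<lambda>s. indicator {0..t} s * ?b s)"
  proof (rule integrableI_bounded_set[where A="{0..t}" and B=B])
    show "AE s\<in>{0..t} in lborel. norm (indicator {0..t} s * ?b s) \<le> B"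
      using nz by eventually_elim (use inside B in auto)
  qed (use t in auto)
  then have "(\<integral>s. indicator {0..t} s * ?b s \<partial>lborel) \<le> (\<integral>s. beta_sup N * indicator {0..t} s \<partial>lborel)"
  proof (rule integral_mono_AE)
    show "integrable lborel (\<lambda>s. beta_sup N * indicator {0..t} s)"
      using t by (intro integrable_mult_right integrable_real_indicator) auto
    show "AE s in lborel. indicator {0..t} s * ?b s \<le> beta_sup N * indicator {0..t} s"
      using nz by eventually_elim (use inside beta_le_beta_sup in \<open>auto split: split_indicator\<close>)
  qed
  then show ?thesis using t by (simp add: set_lebesgue_integral_def)
qed

text \<open>Paths that have left the domain by time \<open>t\<close> have weight 0; for the others
  the end point lies in \<open>D \<times> V\<close> and the exponent is bounded by
  \<open>integral_beta_path_le\<close>.\<close>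

lemma weight_bounds:
  assumes \<omega>: "\<omega> \<in> space (PiM UNIV (\<lambda>_::nat. event_space N))" and t: "0 < t"
    and g: "\<And>r v. r \<in> D \<Longrightarrow> v \<in> V \<Longrightarrow> 0 \<le> g r v \<and> g r v \<le> G"
  shows "0 \<le> weight N t g \<omega>" "weight N t g \<omega> \<le> exp (beta_sup N * t) * G"
proof -
  have G: "0 \<le> G" using g domain_facts(1) V_nonempty by (meson all_not_in_conv order.trans)
  show "0 \<le> weight N t g \<omega>" "weight N t g \<omega> \<le> exp (beta_sup N * t) * G"
  proof (atomize (full), cases "ereal t < exit_time N \<omega>")
    case True
    then have "0 \<le> g (walk_pos \<omega> t) (walk_vel \<omega> t) \<and> g (walk_pos \<omega> t) (walk_vel \<omega> t) \<le> G"
      using t walk_vel_in_V[OF \<omega>] by (intro g walk_pos_in_D) auto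
    moreover have "exp (LINT s:{0..t}|lborel. beta N (walk_pos \<omega> s) (walk_vel \<omega> s)) \<le> exp (beta_sup N * t)"
      using integral_beta_path_le[OF \<omega> _ True] t by simp
    ultimately show "0 \<le> weight N t g \<omega> \<and> weight N t g \<omega> \<le> exp (beta_sup N * t) * G"
      using True by (auto simp: weight_def intro!: mult_mono)
  qed (use G in \<open>auto simp: weight_def\<close>)
qed

section \<open>The mean square error\<close>

lemma Linf_plus_bounded:
  assumes "g \<in> Linf_plus N"
  obtains G where "0 < G" "\<And>r v. r \<in> D \<Longrightarrow> v \<in> V \<Longrightarrow> 0 \<le> g r v \<and> g r v \<le> G"
proof -
  obtain c where "\<And>r v. r \<in> D \<Longrightarrow> v \<in> V \<Longrightarrow> 0 \<le> g r v \<and> g r v \<le> c"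
    using assms unfolding Linf_plus_def by blast
  \<comment> \<open>The maximum with 1 makes the bound positive, so that it can serve as a
    divisor.\<close>
  then show ?thesis using that[of "max c 1"] by (fastforce simp: le_max_iff_disj)
qed

lemma psi_le:
  assumes v: "v \<in> V" and t: "0 < t"
    and g: "\<And>r v. r \<in> D \<Longrightarrow> v \<in> V \<Longrightarrow> 0 \<le> g r v \<and> g r v \<le> G"
  shows "psi N t g r v \<le> exp (beta_sup N * t) * G"
proof -
  interpret W: prob_space "walk_law N r v" using v by (rule prob_space_walk_law)
  have G: "0 \<le> G" using g domain_facts(1) V_nonempty by (meson all_not_in_conv order.trans)
  have "psi N t g r v \<le> W.expectation (\<lambda>_. exp (beta_sup N * t) * G)"
    unfolding psi_def
    by (rule integral_mono') (use weight_bounds(2)[OF _ t g] G space_walk_law[OF v] in auto)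
  then show ?thesis by (simp add: W.prob_space)
qed

section \<open>Leading eigenvalue and long-time limit\<close>

lemma eigenvalue_le_beta_sup:
  assumes triple: "leading_eigentriple N lam \<phi> \<phi>'" and rv: "r \<in> D" "v \<in> V"
  shows "lam \<le> beta_sup N"
proof (rule ccontr)
  assume "\<not> lam \<le> beta_sup N"
  then have d: "0 < lam - beta_sup N" by simp
  have pos: "0 < \<phi> r v" and \<phi>: "\<phi> \<in> Linf_plus N"
    and eig: "\<And>t. 0 \<le> t \<Longrightarrow> psi N t \<phi> r v = exp (lam * t) * \<phi> r v"
    using triple rv unfolding leading_eigentriple_def by blast+
  obtain G where G: "0 < G" "\<And>r v. r \<in> D \<Longrightarrow> v \<in> V \<Longrightarrow> 0 \<le> \<phi> r v \<and> \<phi> r v \<le> G"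
    using Linf_plus_bounded[OF \<phi>] by blast
  \<comment> \<open>At this time the exponent \<open>(lam - beta_sup N) * t\<close> equals
    \<open>x = G / \<phi> r v\<close>, so the comparison of growth rates reads
    \<open>exp x \<le> x\<close>, which is impossible.\<close>
  define t where "t = G / \<phi> r v / (lam - beta_sup N)"
  have t: "0 < t" using d pos G by (simp add: t_def)
  have "exp (lam * t) * \<phi> r v \<le> exp (beta_sup N * t) * G"
    using psi_le[where r=r and v=v and t=t and g=\<phi> and G=G] rv t G eig[of t] by simp
  then have "exp ((lam - beta_sup N) * t) \<le> G / \<phi> r v"
    using pos by (simp add: left_diff_distrib exp_diff field_simps)
  moreover have "(lam - beta_sup N) * t = G / \<phi> r v" using d by (simp add: t_def)
  ultimately show False using exp_ge_add_one_self[of "G / \<phi> r v"] by simp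
qed

text \<open>The eigen-triple gives a uniform estimate for functions bounded by 1. It is applied to
  \<open>g / G\<close>, and the scaling is undone because \<open>psi\<close> and
  \<open>pairing\<close> commute with division by a constant.\<close>

lemma psi_asymptotics:
  assumes triple: "leading_eigentriple N lam \<phi> \<phi>'" and g: "g \<in> Linf_plus N"
    and rv: "r \<in> D" "v \<in> V"
  shows "((\<lambda>t. exp (- lam * t) * psi N t g r v) \<longlongrightarrow> pairing N \<phi>' g * \<phi> r v) at_top"
proof -
  obtain G where G: "0 < G" "\<And>r v. r \<in> D \<Longrightarrow> v \<in> V \<Longrightarrow> 0 \<le> g r v \<and> g r v \<le> G"
    using Linf_plus_bounded[OF g] by blast
  have pos: "0 < \<phi> r v" using triple rv unfolding leading_eigentriple_def by blast
  define h where "h r v = g r v / G" for r v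
  have "h \<in> Linf_plus N"
    using g G unfolding Linf_plus_def h_def case_prod_beta
    by (auto intro!: borel_measurable_divide exI[of _ 1])
  moreover have "h r v \<le> 1" if "r \<in> D" "v \<in> V" for r v using G that by (simp add: h_def)
  moreover obtain \<epsilon> c where \<epsilon>: "0 < \<epsilon>" and *: "\<forall>\<^sub>F t in at_top. \<forall>g\<in>Linf_plus N. (\<forall>r\<in>D. \<forall>v\<in>V. g r v \<le> 1) \<longrightarrow>
      (\<forall>r\<in>D. \<forall>v\<in>V. \<bar>exp (- lam * t) * psi N t g r v / \<phi> r v - pairing N \<phi>' g\<bar> \<le> c * exp (- \<epsilon> * t))"
    using triple unfolding leading_eigentriple_def by blast
  ultimately have "\<forall>\<^sub>F t in at_top.
      norm (exp (- lam * t) * psi N t h r v / \<phi> r v - pairing N \<phi>' h) \<le> c * exp (- \<epsilon> * t)"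
    using rv by (auto elim!: eventually_mono)
  moreover have "((\<lambda>t. c * exp (- \<epsilon> * t)) \<longlongrightarrow> 0) at_top"
  proof -
    have "filterlim (\<lambda>t. \<epsilon> * t) at_top at_top"
      by (rule filterlim_tendsto_pos_mult_at_top[OF tendsto_const \<epsilon> filterlim_ident])
    then have "((\<lambda>t. exp (- (\<epsilon> * t))) \<longlongrightarrow> 0) at_top"
      by (intro filterlim_compose[OF exp_at_bot] filterlim_compose[OF filterlim_uminus_at_bot_at_top])
    then show ?thesis using tendsto_mult_right_zero by fastforce
  qed
  ultimately have "((\<lambda>t. exp (- lam * t) * psi N t h r v / \<phi> r v - pairing N \<phi>' h) \<longlongrightarrow> 0) at_top"
    by (rule Lim_null_comparison)
  then have "((\<lambda>t. exp (- lam * t) * psi N t h r v / \<phi> r v) \<longlongrightarrow> pairing N \<phi>' h) at_top"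
    by (simp add: LIM_zero_iff)
  then have "((\<lambda>t. exp (- lam * t) * psi N t h r v / \<phi> r v * (\<phi> r v * G)) \<longlongrightarrow> pairing N \<phi>' h * (\<phi> r v * G)) at_top"
    by (intro tendsto_mult tendsto_const)
  moreover have "weight N t h \<omega> = weight N t g \<omega> / G" for t \<omega> by (simp add: weight_def h_def)
  then have "psi N t h r v = psi N t g r v / G" for t by (simp add: psi_def)
  moreover have "pairing N \<phi>' h = pairing N \<phi>' g / G"
    unfolding pairing_def h_def case_prod_beta times_divide_eq_right by (rule set_integral_divide_zero)
  ultimately show ?thesis using G pos by simp
qed

text \<open>The pointwise inequality \<open>X^2 \<le> K * X\<close>, with \<open>K\<close> the bound
  on the weight, keeps one factor \<open>X\<close>, so the second moment is at most \<open>K\<close>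
  times the mean. The cruder \<open>X^2 \<le> K^2\<close> would lead only to the exponent
  \<open>2 * beta_sup N\<close> in place of \<open>lambda_star + beta_sup N\<close>.\<close>

lemma mean_square_error_le:
  assumes G: "\<And>r v. r \<in> D \<Longrightarrow> v \<in> V \<Longrightarrow> 0 \<le> g r v \<and> g r v \<le> G"
    and v: "v \<in> V" and t: "1 \<le> t" and k: "1 \<le> k" and m: "0 < psi N t g r v"
  shows "mean_square_error N k g t r v c \<le>
    2 * (psi N t g r v powr (1 / t))\<^sup>2 / psi N t g r v * (exp (beta_sup N * t) * G) / real k
      + 2 * (psi N t g r v powr (1 / t) - c)\<^sup>2"
proof -
  interpret W: prob_space "walk_law N r v" using v by (rule prob_space_walk_law)
  let ?X = "weight N t g" and ?m = "psi N t g r v" and ?K = "exp (beta_sup N * t) * G"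
  \<comment> \<open>Bochner integrals of non-integrable functions are 0.\<close>
  have X: "integrable (walk_law N r v) ?X"
    using m unfolding psi_def by (metis less_irrefl not_integrable_integral_eq)
  have bounds: "0 \<le> ?X \<omega>" "?X \<omega> \<le> ?K" if "\<omega> \<in> space (walk_law N r v)" for \<omega>
    using weight_bounds[of \<omega> t g G] that t G space_walk_law[OF v] by auto
  have X2_le: "(?X \<omega>)\<^sup>2 \<le> ?K * ?X \<omega>" if "\<omega> \<in> space (walk_law N r v)" for \<omega>
    using bounds[OF that] by (simp add: power2_eq_square mult_right_mono)
  have X2: "integrable (walk_law N r v) (\<lambda>\<omega>. (?X \<omega>)\<^sup>2)"
    by (rule Bochner_Integration.integrable_bound[OF integrable_mult_right[OF X, of ?K]])
       (use X X2_le in \<open>auto intro!: AE_I2 order.trans[OF X2_le]\<close>)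
  have "W.expectation (\<lambda>\<omega>. (?X \<omega>)\<^sup>2) \<le> W.expectation (\<lambda>\<omega>. ?K * ?X \<omega>)"
    using X X2 X2_le by (intro integral_mono) auto
  then have E: "W.expectation (\<lambda>\<omega>. (?X \<omega>)\<^sup>2) \<le> ?K * ?m" by (simp add: psi_def)
  have "mean_square_error N k g t r v c \<le>
      2 * (?m powr (1 / t - 1))\<^sup>2 * (W.expectation (\<lambda>\<omega>. (?X \<omega>)\<^sup>2) / real k) + 2 * (?m powr (1 / t) - c)\<^sup>2"
    unfolding mean_square_error_def copies_law_def Psi_rw_def
    by (rule W.sample_mean_powr_error[OF X X2 k]) (use bounds t m in \<open>auto simp: psi_def\<close>)
  also have "\<dots> \<le> 2 * (?m powr (1 / t - 1))\<^sup>2 * (?K * ?m / real k) + 2 * (?m powr (1 / t) - c)\<^sup>2"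
    using E by (intro add_right_mono mult_left_mono divide_right_mono) auto
  also have "?m powr (1 / t - 1) = ?m powr (1 / t) / ?m" using m by (simp add: powr_diff)
  finally show ?thesis using m by (simp add: power_divide power2_eq_square mult_ac)
qed

end

theorem theorem6p1:
  fixes N :: neutron_system
    and lambda_star :: real
    and phi phi_tilde g :: "vec3 \<Rightarrow> vec3 \<Rightarrow> real"
    and r v :: vec3
  assumes "standing_assumptions N"
    and "leading_eigentriple N lambda_star phi phi_tilde"
    and "g \<in> Linf_plus N"
    and "0 < pairing N g phi_tilde"
    and "r \<in> domain N" and "v \<in> velocities N"
  shows "\<exists>kappa1>0. \<exists>lambda1.
     (\<exists>kappa0>0. \<forall>\<^sub>F t in at_top. \<forall>k\<ge>1.
        mean_square_error N k g t r v (exp lambda_star)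
          \<le> kappa1 / real k * exp ((lambda1 - 2 * lambda_star) * t) + kappa0 / t\<^sup>2) \<and>
     (let C0 = pairing N phi_tilde g * phi r v in
        C0 \<noteq> 1 \<longrightarrow>
        (\<forall>\<eta>>0. let kappa0 = 2 * (ln C0 * exp lambda_star)\<^sup>2 + \<eta> in
           \<forall>\<^sub>F t in at_top. \<forall>k\<ge>1.
             mean_square_error N k g t r v (exp lambda_star)
               \<le> kappa1 / real k * exp ((lambda1 - 2 * lambda_star) * t) + kappa0 / t\<^sup>2)) \<and>
     max (2 * lambda_star) (lambda_star + beta_inf N) \<le> lambda1 \<and>
     lambda1 \<le> lambda_star + beta_sup N"
proof -
  interpret neutron_walk N using assms(1) by unfold_locales
  note triple = assms(2) and g = assms(3) and rv = assms(5,6)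
  obtain G where G: "0 < G" "\<And>r v. r \<in> D \<Longrightarrow> v \<in> V \<Longrightarrow> 0 \<le> g r v \<and> g r v \<le> G"
    using Linf_plus_bounded[OF g] by blast
  define C0 where "C0 = pairing N phi_tilde g * phi r v"
  have "0 < phi r v" using triple rv unfolding leading_eigentriple_def by blast
  moreover have "pairing N phi_tilde g = pairing N g phi_tilde" by (simp add: pairing_def mult.commute)
  ultimately have C0: "0 < C0" using assms(4) by (simp add: C0_def)
  define m where "m t = psi N t g r v" for t
  define C where "C t = exp (- lambda_star * t) * m t" for t
  have m_eq: "m t = exp (lambda_star * t) * C t" for t by (simp add: C_def flip: exp_add)
  have C: "(C \<longlongrightarrow> C0) at_top"
    using psi_asymptotics[OF triple g rv] by (simp add: C_def[abs_def] m_def C0_def)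
  have root: "\<forall>\<^sub>F t in at_top. 2 * (m t powr (1 / t) - exp lambda_star)\<^sup>2
      \<le> (2 * (ln C0 * exp lambda_star)\<^sup>2 + \<eta>) / t\<^sup>2" if "0 < \<eta>" for \<eta>
    using eventually_root_error_le[OF C C0 that] by (simp add: m_eq)
  \<comment> \<open>\<open>Q\<close> eventually bounds \<open>(m t powr (1 / t))^2\<close>. It uses
    the bias estimate with the fixed slack 1, since \<open>kappa1\<close> has to be chosen before
    \<open>\<eta>\<close>.\<close>
  define Q where "Q = 2 * (ln C0 * exp lambda_star)\<^sup>2 + 1 + 2 * (exp lambda_star)\<^sup>2"
  \<comment> \<open>One factor 2 comes from \<open>mean_square_error_le\<close>, the other from the
    lower bound \<open>C0 / 2\<close> for \<open>C t\<close>.\<close>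
  define kappa1 where "kappa1 = 4 * Q * G / C0"
  \<comment> \<open>This is the largest admissible value. The lower bound on it reduces to
    \<open>lambda_star \<le> beta_sup N\<close> and
    \<open>beta_inf N \<le> beta_sup N\<close>.\<close>
  define lambda1 where "lambda1 = lambda_star + beta_sup N"
  have Q: "0 < Q" unfolding Q_def by (intro add_nonneg_pos add_pos_nonneg) auto
  \<comment> \<open>The threshold for \<open>t\<close> depends only on the deterministic function
    \<open>m\<close>, so it is uniform in \<open>k\<close>.\<close>
  have main: "\<forall>\<^sub>F t in at_top. \<forall>k\<ge>1. mean_square_error N k g t r v (exp lambda_star)
      \<le> kappa1 / real k * exp ((lambda1 - 2 * lambda_star) * t)
        + (2 * (ln C0 * exp lambda_star)\<^sup>2 + \<eta>) / t\<^sup>2" if "0 < \<eta>" for \<eta>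
  proof -
    have "\<forall>\<^sub>F t in at_top. C0 / 2 < C t" using C C0 by (intro order_tendstoD(1)) auto
    with root[OF that] root[OF zero_less_one] eventually_ge_at_top[of 1] show ?thesis
    proof eventually_elim
      case (elim t)
      then have m_pos: "0 < m t" using C0 by (simp add: m_eq)
      have "(m t powr (1 / t))\<^sup>2 \<le> 2 * (m t powr (1 / t) - exp lambda_star)\<^sup>2 + 2 * (exp lambda_star)\<^sup>2"
        using sum_squares_bound[of "m t powr (1 / t) - exp lambda_star" "exp lambda_star"]
        by (simp add: power2_eq_square algebra_simps)
      also have "2 * (m t powr (1 / t) - exp lambda_star)\<^sup>2 \<le> 2 * (ln C0 * exp lambda_star)\<^sup>2 + 1"
      proof -
        have "1 \<le> t\<^sup>2" using elim by simp
        then have "(2 * (ln C0 * exp lambda_star)\<^sup>2 + 1) / t\<^sup>2 \<le> (2 * (ln C0 * exp lambda_star)\<^sup>2 + 1) / 1"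
          by (intro divide_left_mono) auto
        then show ?thesis using elim by simp
      qed
      finally have Q_le: "(m t powr (1 / t))\<^sup>2 \<le> Q" by (simp add: Q_def)
      have "2 * (m t powr (1 / t))\<^sup>2 / m t * (exp (beta_sup N * t) * G)
          \<le> 2 * Q / (exp (lambda_star * t) * (C0 / 2)) * (exp (beta_sup N * t) * G)"
        using Q_le Q G C0 elim m_pos unfolding m_eq
        by (intro mult_right_mono frac_le mult_left_mono) auto
      also have "\<dots> = kappa1 * exp ((lambda1 - 2 * lambda_star) * t)"
        using C0 by (simp add: kappa1_def lambda1_def exp_diff algebra_simps field_simps)
      finally have first: "2 * (m t powr (1 / t))\<^sup>2 / m t * (exp (beta_sup N * t) * G)
          \<le> kappa1 * exp ((lambda1 - 2 * lambda_star) * t)" .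
      show ?case
      proof (intro allI impI)
        fix k :: nat assume k: "1 \<le> k"
        have "mean_square_error N k g t r v (exp lambda_star)
            \<le> 2 * (m t powr (1 / t))\<^sup>2 / m t * (exp (beta_sup N * t) * G) / real k
              + 2 * (m t powr (1 / t) - exp lambda_star)\<^sup>2"
          unfolding m_def using elim m_pos k
          by (intro mean_square_error_le G(2) rv(2)) (simp_all add: m_def)
        also have "\<dots> \<le> kappa1 * exp ((lambda1 - 2 * lambda_star) * t) / real k
            + (2 * (ln C0 * exp lambda_star)\<^sup>2 + \<eta>) / t\<^sup>2"
          using elim by (intro add_mono divide_right_mono first) auto
        finally show "mean_square_error N k g t r v (exp lambda_star)
            \<le> kappa1 / real k * exp ((lambda1 - 2 * lambda_star) * t)
              + (2 * (ln C0 * exp lambda_star)\<^sup>2 + \<eta>) / t\<^sup>2" by simp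
      qed
    qed
  qed
  have "0 < kappa1" using Q G C0 by (simp add: kappa1_def)
  moreover have "\<exists>kappa0>0. \<forall>\<^sub>F t in at_top. \<forall>k\<ge>1. mean_square_error N k g t r v (exp lambda_star)
      \<le> kappa1 / real k * exp ((lambda1 - 2 * lambda_star) * t) + kappa0 / t\<^sup>2"
    \<comment> \<open>The slack 1 keeps \<open>kappa0\<close> positive even when
      \<open>C0 = 1\<close> and the logarithm vanishes.\<close>
    using main[of 1] by (intro exI[of _ "2 * (ln C0 * exp lambda_star)\<^sup>2 + 1"]) (auto intro: add_nonneg_pos)
  moreover have "max (2 * lambda_star) (lambda_star + beta_inf N) \<le> lambda1"
    using eigenvalue_le_beta_sup[OF triple rv] beta_inf_le_beta[OF rv] beta_le_beta_sup[OF rv]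
    by (simp add: lambda1_def)
  moreover have "lambda1 \<le> lambda_star + beta_sup N" by (simp add: lambda1_def)
  ultimately show ?thesis
    using main unfolding Let_def C0_def[symmetric] by blast
qed

end
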